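(* Let $\mathfrak g$ be a finite-dimensional semi-simple complex Lie algebra with Killing form $\kappa$, and let the crossed module $\mu:V_2\to E=V_3\times_\alpha\mathfrak g$, $\mu(v)=(d(v),0)$, be any abelian representative for the cohomology class in $H^3(\mathfrak g,\mathbb C)$ represented by the Cartan cocycle $\kappa([-,-],-)$; here $0\to\mathbb C\xrightarrow{i}V_2\xrightarrow{d}V_3\to0$ is the underlying short exact sequence of $\mathfrak g$-modules ($\mathbb C$ trivial) and $\alpha\in Z^2(\mathfrak g,V_3)$. Let $Q:V_3\to V_2$ be a linear section of $d$ and $\omega=Q\circ\alpha$. Let $r_\kappa=\sum_i s_i\otimes t_i$ be the standard $r$-matrix of $(\mathfrak g,\kappa)$. For $X\in\mathfrak g$, $h\in V_3$ write $\overline X=(0,X)$, $\overline h=(h,0)\in E$, and put $1_{V_2}=i(1)$. Let $\overline r_\kappa=\sum_i\overline s_i\otimes\overline t_i$, let $c\in\ker(\mu)=i(\mathbb C)$, and let $\xi=-\xi_0-C:E\to(E\otimes V_2)\oplus(V_2\otimes E)$, where $\xi_0$ and $C$ are linear with $$\xi_0(\overline X)=\sum_i\big(\omega(s_i,X)\otimes\overline t_i+\overline s_i\otimes\omega(t_i,X)\big),\quad \xi_0(\overline h)=\sum_i\big((s_i\cdot Q(h))\otimes\overline t_i+\overline s_i\otimes(t_i\cdot Q(h))\big),$$ $$C(h,X)=1_{V_2}\otimes\overline X+\overline X\otimes1_{V_2}.$$ Then the triple $(\overline r_\kappa,\xi,c)$ is a quasi-invariant tensor for $\mu$.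
   Context: The standard $r$-matrix is $r_\kappa=\frac12\sum_{i}(x_i\otimes x^i+x^i\otimes x_i)$ for any basis $(x_i)$ of $\mathfrak g$ with $\kappa$-dual basis $(x^i)$, $\kappa(x_i,x^j)=\delta_{i,j}$ (independent of the basis). A crossed module of Lie algebras is a Lie algebra homomorphism $\mu:\mathfrak m\to\mathfrak n$ with an action of $\mathfrak n$ on $\mathfrak m$ by derivations such that $\mu(n\cdot m)=[n,\mu(m)]$ and $\mu(m)\cdot m'=[m,m']$. Equivalence classes of crossed modules with cokernel $\mathfrak g$ and kernel the $\mathfrak g$-module $V$ correspond bijectively to $H^3(\mathfrak g,V)$ (Gerstenhaber). Given a short exact sequence of $\mathfrak g$-modules $0\to V_1\to V_2\xrightarrow{d}V_3\to0$ and $\alpha\in Z^2(\mathfrak g,V_3)$, $V_3\times_\alpha\mathfrak g$ is $V_3\oplus\mathfrak g$ with bracket $[(h,X),(h',Y)]=(X\cdot h'-Y\cdot h+\alpha(X,Y),[X,Y])$; $V_2$ is regarded as an abelian Lie algebra on which $V_3\times_\alpha\mathfrak g$ acts via the projection to $\mathfrak g$, and $\mu(v)=(d(v),0)$ defines a crossed module $V_2\to V_3\times_\alpha\mathfrak g$, whose class in $H^3(\mathfrak g,V_1)$ is $\partial[\alpha]$, with $\partial:H^2(\mathfrak g,V_3)\to H^3(\mathfrak g,V_1)$ the connecting homomorphism. An abelian representative of a class $[\gamma]\in H^3(\mathfrak g,V_1)$ is a crossed module of this form lying in the equivalence class of crossed modules corresponding to $[\gamma]$, i.e. with $\partial[\alpha]=[\gamma]$.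 Here $V_1=\mathbb C$ is the trivial module. Let $\mu:\mathfrak m\to\mathfrak n$ be a crossed module, $\mathfrak e=\mathfrak m\rtimes\mathfrak n$ the semidirect product, and $\beta:\mathfrak e\to\mathfrak n$, $\beta(v,X)=\mu(v)+X$, extended to $\beta:U(\mathfrak e^{\oplus n})\to U(\mathfrak n^{\oplus n})$. Let $A_n\subset U(\mathfrak e^{\oplus n})$ be the smallest vector subspace containing all $xvy$ with $x,y\in U(\mathfrak n^{\oplus n})$, $v\in\mathfrak m^{\oplus n}$, and $\mathcal U^{(n)}$ the quotient of $A_n$ by the relations $x\mu(u)yvz=xuy\mu(v)z$ for $x,y,z\in U(\mathfrak n^{\oplus n})$, $u,v\in\mathfrak m^{\oplus n}$. With $U(\mathfrak e\oplus\mathfrak e)=U(\mathfrak e)\otimes U(\mathfrak e)$, the space $(\mathfrak n\otimes\mathfrak m)\oplus(\mathfrak m\otimes\mathfrak n)$ lies in $A_2$ and maps to $\mathcal U^{(2)}$. For $r=\sum_i s_i\otimes t_i\in\mathfrak n\otimes\mathfrak n$, $u\in\mathfrak m$: $u\cdot r=-\sum_i\big((s_i\cdot u)\otimes t_i+s_i\otimes(t_i\cdot u)\big)$. $\mathfrak n$ acts diagonally on $\mathfrak n\otimes\mathfrak n$, $\mathfrak n\otimes\mathfrak m$, $\mathfrak m\otimes\mathfrak n$. A quasi-invariant tensor in $\mu:\mathfrak m\to\mathfrak n$ consists of a symmetric tensor $r\in\mathfrak n\otimes\mathfrak n$, a linear map $\xi:\mathfrak n\to(\mathfrak n\otimes\mathfrak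 m)\oplus(\mathfrak m\otimes\mathfrak n)$ with each $\xi(X)$ invariant under the flip of tensor factors, and an $\mathfrak n$-invariant $c\in\ker(\mu)$, such that (a) $X\cdot r=\beta(\xi(X))$ for all $X\in\mathfrak n$; (b) $u\cdot r=\xi(\mu(u))$ for all $u\in\mathfrak m$; (c) $\xi([X,Y])=X\cdot\xi(Y)-Y\cdot\xi(X)$ for all $X,Y\in\mathfrak n$; where (b), (c) are read as equalities in $\mathcal U^{(2)}$.
   Formalization: The section Q is also assumed to satisfy δ(Q∘α) = i∘κ([-,-],-) exactly, not only up to a coboundary; for an arbitrary linear section the claim fails (e.g. for sl_3), and this condition is necessary for (c). *)

theory Defs
  imports Complex_Main "HOL-Library.Poly_Mapping" "HOL-Library.Product_Plus"
begin

section \<open>Complex vector spaces\<close>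

text \<open>Complex vector spaces are types of the following class; no dimension restriction is
  built in.\<close>

class complex_vs = ab_group_add +
  fixes scaleC :: "complex \<Rightarrow> 'a \<Rightarrow> 'a"  (infixr \<open>*\<^sub>C\<close> 75)
  assumes scaleC_add_right: "a *\<^sub>C (x + y) = a *\<^sub>C x + a *\<^sub>C y"
    and scaleC_add_left: "(a + b) *\<^sub>C x = a *\<^sub>C x + b *\<^sub>C x"
    and scaleC_scaleC: "a *\<^sub>C (b *\<^sub>C x) = (a * b) *\<^sub>C x"
    and scaleC_one: "1 *\<^sub>C x = x"

global_interpretation cvs: vector_space "scaleC :: complex \<Rightarrow> 'a \<Rightarrow> 'a::complex_vs"
  by unfold_locales (simp_all add: scaleC_add_right scaleC_add_left scaleC_scaleC scaleC_one)

instantiation complex :: complex_vs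
begin
definition scaleC_complex :: "complex \<Rightarrow> complex \<Rightarrow> complex"
  where "scaleC_complex = (*)"
instance by standard (simp_all add: scaleC_complex_def algebra_simps)
end

instantiation prod :: (complex_vs, complex_vs) complex_vs
begin
definition scaleC_prod :: "complex \<Rightarrow> 'a \<times> 'b \<Rightarrow> 'a \<times> 'b"
  where "scaleC_prod c p = (c *\<^sub>C fst p, c *\<^sub>C snd p)"
instance
  by standard (simp_all add: scaleC_prod_def scaleC_add_right scaleC_add_left scaleC_scaleC scaleC_one)
end

instantiation poly_mapping :: (type, complex_vs) complex_vs
begin
lift_definition scaleC_poly_mapping :: "complex \<Rightarrow> ('a \<Rightarrow>\<^sub>0 'b) \<Rightarrow> ('a \<Rightarrow>\<^sub>0 'b)"
  is "\<lambda>c f x. c *\<^sub>C f x"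
  by (erule rev_finite_subset) auto
instance
  by (standard; transfer)
    (simp_all add: fun_eq_iff scaleC_add_right scaleC_add_left scaleC_scaleC scaleC_one)
end

abbreviation clinear :: "('a::complex_vs \<Rightarrow> 'b::complex_vs) \<Rightarrow> bool"
  where "clinear \<equiv> Vector_Spaces.linear scaleC scaleC"

lemma clinear_iff:
  "clinear f \<longleftrightarrow> (\<forall>x y. f (x + y) = f x + f y) \<and> (\<forall>c x. f (c *\<^sub>C x) = c *\<^sub>C f x)"
  unfolding Vector_Spaces.linear_def module_hom_def module_hom_axioms_def
  by (auto intro: cvs.vector_space_axioms cvs.module_axioms)

definition cbilinear :: "('a::complex_vs \<Rightarrow> 'b::complex_vs \<Rightarrow> 'c::complex_vs) \<Rightarrow> bool"
  where "cbilinear f \<longleftrightarrow> (\<forall>y. clinear (\<lambda>x. f x y)) \<and> (\<forall>x. clinear (\<lambda>y. f x y))"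

definition finite_dim :: "'a::complex_vs itself \<Rightarrow> bool"
  where "finite_dim _ \<longleftrightarrow> (\<exists>B :: 'a set. finite B \<and> cvs.span B = UNIV)"

text \<open>Trace of an endomorphism of a finite-dimensional space.  The value does not depend on the
  chosen basis.\<close>

definition ctrace :: "('a::complex_vs \<Rightarrow> 'a) \<Rightarrow> complex"
  where "ctrace f = (let B = SOME B. cvs.independent B \<and> cvs.span B = UNIV
                     in \<Sum>b\<in>B. cvs.representation B (f b) b)"

section \<open>Tensor products\<close>

text \<open>The tensor product is the free vector space on pairs modulo the bilinearity relations.\<close>

definition tensor_null :: "('a::complex_vs \<times> 'b::complex_vs \<Rightarrow>\<^sub>0 complex) set"
  where "tensor_null = cvs.span
     ({Poly_Mapping.single (x + x', y) 1 - Poly_Mapping.single (x, y) 1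
         - Poly_Mapping.single (x', y) 1 | x x' y. True}
    \<union> {Poly_Mapping.single (x, y + y') 1 - Poly_Mapping.single (x, y) 1
         - Poly_Mapping.single (x, y') 1 | x y y'. True}
    \<union> {Poly_Mapping.single (c *\<^sub>C x, y) 1 - Poly_Mapping.single (x, y) c | c x y. True}
    \<union> {Poly_Mapping.single (x, c *\<^sub>C y) 1 - Poly_Mapping.single (x, y) c | c x y. True})"

definition tensor_rel ::
    "('a::complex_vs \<times> 'b::complex_vs \<Rightarrow>\<^sub>0 complex) \<Rightarrow> ('a \<times> 'b \<Rightarrow>\<^sub>0 complex) \<Rightarrow> bool"
  where "tensor_rel p q \<longleftrightarrow> p - q \<in> tensor_null"

lemma subspace_tensor_null: "cvs.subspace tensor_null"
  unfolding tensor_null_def by (rule cvs.subspace_span)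

lemma tensor_rel_refl: "tensor_rel p p"
  by (simp add: tensor_rel_def cvs.subspace_0 subspace_tensor_null)

lemma tensor_rel_add: "tensor_rel p p' \<Longrightarrow> tensor_rel q q' \<Longrightarrow> tensor_rel (p + q) (p' + q')"
  unfolding tensor_rel_def add_diff_add
  by (rule cvs.subspace_add[OF subspace_tensor_null])

lemma tensor_rel_scale: "tensor_rel p p' \<Longrightarrow> tensor_rel (c *\<^sub>C p) (c *\<^sub>C p')"
  unfolding tensor_rel_def cvs.scale_right_diff_distrib[symmetric]
  by (rule cvs.subspace_scale[OF subspace_tensor_null])

lemma tensor_rel_uminus: "tensor_rel p p' \<Longrightarrow> tensor_rel (- p) (- p')"
  using tensor_rel_scale[of p p' "- 1"] by simp

lemma tensor_rel_diff: "tensor_rel p p' \<Longrightarrow> tensor_rel q q' \<Longrightarrow> tensor_rel (p - q) (p' - q')"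
  using tensor_rel_add[OF _ tensor_rel_uminus, of p p' q q'] by simp

lemma tensor_rel_sym: "tensor_rel p q \<Longrightarrow> tensor_rel q p"
  unfolding tensor_rel_def using cvs.subspace_neg[OF subspace_tensor_null] by fastforce

lemma tensor_rel_trans: "tensor_rel p q \<Longrightarrow> tensor_rel q r \<Longrightarrow> tensor_rel p r"
  unfolding tensor_rel_def using cvs.subspace_add[OF subspace_tensor_null, of "p - q" "q - r"]
  by simp

lemma equivp_tensor_rel: "equivp tensor_rel"
  by (rule equivpI[OF reflpI[OF tensor_rel_refl] sympI[OF tensor_rel_sym] transpI[OF tensor_rel_trans]])

quotient_type (overloaded) ('a, 'b) tensor =
    "'a::complex_vs \<times> 'b::complex_vs \<Rightarrow>\<^sub>0 complex" / tensor_rel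
  by (rule equivp_tensor_rel)

instantiation tensor :: (complex_vs, complex_vs) complex_vs
begin

lift_definition zero_tensor :: "('a, 'b) tensor" is 0 .

lift_definition plus_tensor :: "('a, 'b) tensor \<Rightarrow> ('a, 'b) tensor \<Rightarrow> ('a, 'b) tensor" is "(+)"
  by (rule tensor_rel_add)

lift_definition uminus_tensor :: "('a, 'b) tensor \<Rightarrow> ('a, 'b) tensor" is uminus
  by (rule tensor_rel_uminus)

lift_definition minus_tensor :: "('a, 'b) tensor \<Rightarrow> ('a, 'b) tensor \<Rightarrow> ('a, 'b) tensor" is "(-)"
  by (rule tensor_rel_diff)

lift_definition scaleC_tensor :: "complex \<Rightarrow> ('a, 'b) tensor \<Rightarrow> ('a, 'b) tensor" is scaleC
  by (rule tensor_rel_scale)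

instance
proof
  fix a b :: complex and x y z :: "('a, 'b) tensor"
  show "x + y + z = x + (y + z)" by transfer (simp only: add.assoc tensor_rel_refl)
  show "x + y = y + x" by transfer (simp only: add.commute tensor_rel_refl)
  show "0 + x = x" by transfer (simp only: add_0 tensor_rel_refl)
  show "- x + x = 0" by transfer (simp only: left_minus tensor_rel_refl)
  show "x - y = x + - y" by transfer (simp only: diff_conv_add_uminus tensor_rel_refl)
  show "a *\<^sub>C (x + y) = a *\<^sub>C x + a *\<^sub>C y"
    by transfer (simp only: scaleC_add_right tensor_rel_refl)
  show "(a + b) *\<^sub>C x = a *\<^sub>C x + b *\<^sub>C x"
    by transfer (simp only: scaleC_add_left tensor_rel_refl)
  show "a *\<^sub>C (b *\<^sub>C x) = (a * b) *\<^sub>C x"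
    by transfer (simp only: scaleC_scaleC tensor_rel_refl)
  show "1 *\<^sub>C x = x"
    by transfer (simp only: scaleC_one tensor_rel_refl)
qed

end

lift_definition tensor :: "'a::complex_vs \<Rightarrow> 'b::complex_vs \<Rightarrow> ('a, 'b) tensor"  (infixl \<open>\<otimes>\<close> 76)
  is "\<lambda>x y. Poly_Mapping.single (x, y) 1" .

definition free_eval ::
    "('a::complex_vs \<Rightarrow> 'b::complex_vs \<Rightarrow> 'c::complex_vs) \<Rightarrow> ('a \<times> 'b \<Rightarrow>\<^sub>0 complex) \<Rightarrow> 'c"
  where "free_eval f p = (\<Sum>k\<in>Poly_Mapping.keys p. Poly_Mapping.lookup p k *\<^sub>C f (fst k) (snd k))"

text \<open>The linear map on the tensor product induced by a map of two arguments; only meaningful for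
  bilinear maps, for which it does not depend on the representative.\<close>

definition tensor_lift ::
    "('a::complex_vs \<Rightarrow> 'b::complex_vs \<Rightarrow> 'c::complex_vs) \<Rightarrow> ('a, 'b) tensor \<Rightarrow> 'c"
  where "tensor_lift f t = free_eval f (rep_tensor t)"

lemma cbilinear_tensor: "cbilinear (\<otimes>)"
proof -
  have 1: "(x + x') \<otimes> y = x \<otimes> y + x' \<otimes> y" for x x' :: 'a and y :: 'b
    by transfer (simp only: tensor_rel_def tensor_null_def diff_diff_eq[symmetric], rule cvs.span_base, blast)
  have 2: "x \<otimes> (y + y') = x \<otimes> y + x \<otimes> y'" for x :: 'a and y y' :: 'b
    by transfer (simp only: tensor_rel_def tensor_null_def diff_diff_eq[symmetric], rule cvs.span_base, blast)
  have scale: "c *\<^sub>C Poly_Mapping.single k (1 :: complex) = Poly_Mapping.single k c"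
    for c and k :: "'a \<times> 'b"
    by (rule poly_mapping_eqI) (simp add: scaleC_poly_mapping.rep_eq lookup_single scaleC_complex_def when_def)
  have 3: "(c *\<^sub>C x) \<otimes> y = c *\<^sub>C (x \<otimes> y)" for c and x :: 'a and y :: 'b
    by transfer (simp only: scale tensor_rel_def tensor_null_def, rule cvs.span_base, blast)
  have 4: "x \<otimes> (c *\<^sub>C y) = c *\<^sub>C (x \<otimes> y)" for c and x :: 'a and y :: 'b
    by transfer (simp only: scale tensor_rel_def tensor_null_def, rule cvs.span_base, blast)
  show ?thesis
    unfolding cbilinear_def clinear_iff by (simp add: 1 2 3 4)
qed

lemma free_eval_superset:
  assumes "finite K" "Poly_Mapping.keys p \<subseteq> K"
  shows "free_eval f p = (\<Sum>k\<in>K. Poly_Mapping.lookup p k *\<^sub>C f (fst k) (snd k))"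
  unfolding free_eval_def using assms
  by (intro sum.mono_neutral_left) (auto simp: in_keys_iff)

lemma free_eval_single: "free_eval f (Poly_Mapping.single k c) = c *\<^sub>C f (fst k) (snd k)"
  by (subst free_eval_superset[of "{k}"]) auto

lemma clinear_free_eval: "clinear (free_eval f)"
proof -
  have "free_eval f (p + q) = free_eval f p + free_eval f q" for p q
  proof -
    let ?K = "Poly_Mapping.keys p \<union> Poly_Mapping.keys q"
    have "free_eval f (p + q) = (\<Sum>k\<in>?K. Poly_Mapping.lookup (p + q) k *\<^sub>C f (fst k) (snd k))"
      by (rule free_eval_superset) (simp_all add: keys_add)
    also have "\<dots> = free_eval f p + free_eval f q"
      by (simp add: free_eval_superset[of ?K p] free_eval_superset[of ?K q]
          lookup_add scaleC_add_left sum.distrib)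
    finally show ?thesis .
  qed
  moreover have "free_eval f (c *\<^sub>C p) = c *\<^sub>C free_eval f p" for c p
  proof -
    have "free_eval f (c *\<^sub>C p)
        = (\<Sum>k\<in>Poly_Mapping.keys p. Poly_Mapping.lookup (c *\<^sub>C p) k *\<^sub>C f (fst k) (snd k))"
      by (rule free_eval_superset)
        (auto simp: in_keys_iff scaleC_poly_mapping.rep_eq scaleC_complex_def)
    also have "\<dots> = c *\<^sub>C free_eval f p"
      by (simp add: free_eval_def scaleC_poly_mapping.rep_eq scaleC_complex_def cvs.scale_sum_right)
    finally show ?thesis .
  qed
  ultimately show ?thesis by (simp add: clinear_iff)
qed

lemma free_eval_tensor_null:
  assumes "cbilinear f" "p \<in> tensor_null"
  shows "free_eval f p = 0"
proof -
  interpret Vector_Spaces.linear scaleC scaleC "free_eval f" by (rule clinear_free_eval)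
  have "cvs.subspace {p. free_eval f p = 0}"
    by (auto simp: cvs.subspace_def add scale zero)
  moreover have f: "f (x + x') y = f x y + f x' y" "f x (y + y') = f x y + f x y'"
      "f (c *\<^sub>C x) y = c *\<^sub>C f x y" "f x (c *\<^sub>C y) = c *\<^sub>C f x y" for x x' y y' c
    using assms(1) by (auto simp: cbilinear_def clinear_iff)
  ultimately show ?thesis
    using assms(2) unfolding tensor_null_def
    by (elim cvs.span_induct) (auto simp: diff free_eval_single f)
qed

lemma rep_tensor_abs: "tensor_rel (rep_tensor (abs_tensor p)) p"
  using Quotient_rep_abs[OF Quotient_tensor tensor_rel_refl] .

lemma tensor_lift_abs:
  assumes "cbilinear f"
  shows "tensor_lift f (abs_tensor p) = free_eval f p"
proof -
  interpret Vector_Spaces.linear scaleC scaleC "free_eval f" by (rule clinear_free_eval)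
  have "free_eval f (rep_tensor (abs_tensor p) - p) = 0"
    using rep_tensor_abs[of p] assms free_eval_tensor_null unfolding tensor_rel_def by blast
  then show ?thesis by (simp add: tensor_lift_def diff)
qed

lemma tensor_lift_tensor:
  assumes "cbilinear f"
  shows "tensor_lift f (x \<otimes> y) = f x y"
  by (simp add: tensor.abs_eq tensor_lift_abs[OF assms] free_eval_single)

lemma clinear_tensor_lift:
  assumes "cbilinear f"
  shows "clinear (tensor_lift f)"
proof -
  interpret Vector_Spaces.linear scaleC scaleC "free_eval f" by (rule clinear_free_eval)
  have "tensor_lift f (s + t) = tensor_lift f s + tensor_lift f t" for s t
    by (induction s rule: tensor.abs_induct, induction t rule: tensor.abs_induct)
      (simp add: plus_tensor.abs_eq tensor_lift_abs[OF assms] add)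
  moreover have "tensor_lift f (c *\<^sub>C t) = c *\<^sub>C tensor_lift f t" for c t
    by (induction t rule: tensor.abs_induct)
      (simp add: scaleC_tensor.abs_eq tensor_lift_abs[OF assms] scale)
  ultimately show ?thesis by (simp add: clinear_iff)
qed

definition tensor_flip :: "('a::complex_vs, 'b::complex_vs) tensor \<Rightarrow> ('b, 'a) tensor"
  where "tensor_flip = tensor_lift (\<lambda>x y. y \<otimes> x)"

section \<open>Tensor algebra and universal enveloping algebra\<close>

text \<open>Words under concatenation form a monoid, so that \<^typ>\<open>'a list \<Rightarrow>\<^sub>0 complex\<close> with its convolution
  product is the free associative unital algebra on the set of elements of \<^typ>\<open>'a\<close>.\<close>

instantiation list :: (type) monoid_add
begin
definition zero_list :: "'a list" where "zero_list = []"
definition plus_list :: "'a list \<Rightarrow> 'a list \<Rightarrow> 'a list" where "plus_list = (@)"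
instance by standard (simp_all add: zero_list_def plus_list_def)
end

inductive_set two_sided_ideal :: "'r::ring_1 set \<Rightarrow> 'r set" for S where
  zero: "0 \<in> two_sided_ideal S"
| gen: "x \<in> S \<Longrightarrow> x \<in> two_sided_ideal S"
| add: "x \<in> two_sided_ideal S \<Longrightarrow> y \<in> two_sided_ideal S \<Longrightarrow> x + y \<in> two_sided_ideal S"
| mult_left: "x \<in> two_sided_ideal S \<Longrightarrow> a * x \<in> two_sided_ideal S"
| mult_right: "x \<in> two_sided_ideal S \<Longrightarrow> x * a \<in> two_sided_ideal S"

lemma two_sided_ideal_uminus: "x \<in> two_sided_ideal S \<Longrightarrow> - x \<in> two_sided_ideal S"
  by (metis mult_minus1 two_sided_ideal.mult_left)

lemma two_sided_ideal_diff:
  "x \<in> two_sided_ideal S \<Longrightarrow> y \<in> two_sided_ideal S \<Longrightarrow> x - y \<in> two_sided_ideal S"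
  by (metis diff_conv_add_uminus two_sided_ideal.add two_sided_ideal_uminus)

text \<open>The tensor algebra of a vector space is the free algebra modulo the linearity relations
  between its generators.\<close>

definition talg_null :: "('a::complex_vs list \<Rightarrow>\<^sub>0 complex) set"
  where "talg_null = two_sided_ideal
     ({Poly_Mapping.single [x + y] 1 - Poly_Mapping.single [x] 1 - Poly_Mapping.single [y] 1
         | x y. True}
    \<union> {Poly_Mapping.single [c *\<^sub>C x] 1 - Poly_Mapping.single [x] c | c x. True})"

definition talg_rel ::
    "('a::complex_vs list \<Rightarrow>\<^sub>0 complex) \<Rightarrow> ('a list \<Rightarrow>\<^sub>0 complex) \<Rightarrow> bool"
  where "talg_rel p q \<longleftrightarrow> p - q \<in> talg_null"

lemma talg_null_diff: "p \<in> talg_null \<Longrightarrow> q \<in> talg_null \<Longrightarrow> p - q \<in> talg_null"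
  unfolding talg_null_def by (rule two_sided_ideal_diff)

lemma talg_rel_refl: "talg_rel p p"
  by (simp add: talg_rel_def talg_null_def two_sided_ideal.zero)

lemma talg_rel_add: "talg_rel p p' \<Longrightarrow> talg_rel q q' \<Longrightarrow> talg_rel (p + q) (p' + q')"
  unfolding talg_rel_def add_diff_add talg_null_def by (rule two_sided_ideal.add)

lemma talg_rel_uminus: "talg_rel p p' \<Longrightarrow> talg_rel (- p) (- p')"
  unfolding talg_rel_def minus_diff_minus talg_null_def by (rule two_sided_ideal_uminus)

lemma talg_rel_diff: "talg_rel p p' \<Longrightarrow> talg_rel q q' \<Longrightarrow> talg_rel (p - q) (p' - q')"
  using talg_rel_add[OF _ talg_rel_uminus, of p p' q q'] by simp

lemma talg_rel_sym: "talg_rel p q \<Longrightarrow> talg_rel q p"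
  unfolding talg_rel_def talg_null_def using two_sided_ideal_uminus by fastforce

lemma talg_rel_trans: "talg_rel p q \<Longrightarrow> talg_rel q r \<Longrightarrow> talg_rel p r"
  unfolding talg_rel_def talg_null_def using two_sided_ideal.add[of "p - q" _ "q - r"] by simp

lemma talg_rel_mult:
  assumes "talg_rel p p'" "talg_rel q q'"
  shows "talg_rel (p * q) (p' * q')"
proof -
  have "p * q - p' * q' = (p - p') * q + p' * (q - q')" by (simp add: algebra_simps)
  with assms show ?thesis
    unfolding talg_rel_def talg_null_def
    by (auto intro: two_sided_ideal.add two_sided_ideal.mult_left two_sided_ideal.mult_right)
qed

lemma equivp_talg_rel: "equivp talg_rel"
  by (rule equivpI[OF reflpI[OF talg_rel_refl] sympI[OF talg_rel_sym] transpI[OF talg_rel_trans]])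

lemma lookup_mult_Nil:
  fixes p q :: "'a list \<Rightarrow>\<^sub>0 complex"
  shows "Poly_Mapping.lookup (p * q) [] = Poly_Mapping.lookup p [] * Poly_Mapping.lookup q []"
proof -
  have *: "(\<Sum>r. Poly_Mapping.lookup q r when [] = l + r) = (Poly_Mapping.lookup q [] when l = [])"
    for l :: "'a list"
  proof (cases "l = []")
    case True
    then show ?thesis by (simp add: plus_list_def)
  next
    case False
    then show ?thesis by (simp add: plus_list_def)
  qed
  show ?thesis
    by (simp add: lookup_mult * mult_when)
qed

lemma lookup_talg_null:
  assumes "p \<in> talg_null"
  shows "Poly_Mapping.lookup p [] = 0"
  using assms unfolding talg_null_def
proof (induction rule: two_sided_ideal.induct)
  case (gen p)
  then show ?case by (auto simp: lookup_minus lookup_single)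
qed (simp_all add: lookup_add lookup_mult_Nil)

lemma scaleC_eq_mult:
  fixes p :: "'a list \<Rightarrow>\<^sub>0 complex"
  shows "c *\<^sub>C p = Poly_Mapping.single 0 c * p"
  by (rule poly_mapping_eqI)
    (simp add: lookup_mult lookup_single scaleC_poly_mapping.rep_eq scaleC_complex_def when_mult)

lemma talg_rel_scale: "talg_rel p p' \<Longrightarrow> talg_rel (c *\<^sub>C p) (c *\<^sub>C p')"
  unfolding scaleC_eq_mult by (rule talg_rel_mult[OF talg_rel_refl])

quotient_type (overloaded) 'a talg = "'a::complex_vs list \<Rightarrow>\<^sub>0 complex" / talg_rel
  by (rule equivp_talg_rel)

instantiation talg :: (complex_vs) ring_1
begin

lift_definition zero_talg :: "'a talg" is 0 .

lift_definition one_talg :: "'a talg" is 1 .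

lift_definition plus_talg :: "'a talg \<Rightarrow> 'a talg \<Rightarrow> 'a talg" is "(+)"
  by (rule talg_rel_add)

lift_definition uminus_talg :: "'a talg \<Rightarrow> 'a talg" is uminus
  by (rule talg_rel_uminus)

lift_definition minus_talg :: "'a talg \<Rightarrow> 'a talg \<Rightarrow> 'a talg" is "(-)"
  by (rule talg_rel_diff)

lift_definition times_talg :: "'a talg \<Rightarrow> 'a talg \<Rightarrow> 'a talg" is "(*)"
  by (rule talg_rel_mult)

instance
proof
  fix a b c :: "'a talg"
  show "a + b + c = a + (b + c)" by transfer (simp only: add.assoc talg_rel_refl)
  show "a + b = b + a" by transfer (simp only: add.commute talg_rel_refl)
  show "0 + a = a" by transfer (simp only: add_0 talg_rel_refl)
  show "- a + a = 0" by transfer (simp only: left_minus talg_rel_refl)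
  show "a - b = a + - b" by transfer (simp only: diff_conv_add_uminus talg_rel_refl)
  show "a * b * c = a * (b * c)" by transfer (simp only: mult.assoc talg_rel_refl)
  show "1 * a = a" by transfer (simp only: mult_1_left talg_rel_refl)
  show "a * 1 = a" by transfer (simp only: mult_1_right talg_rel_refl)
  show "(a + b) * c = a * c + b * c" by transfer (simp only: distrib_right talg_rel_refl)
  show "a * (b + c) = a * b + a * c" by transfer (simp only: distrib_left talg_rel_refl)
  have "\<not> talg_rel (0 :: 'a list \<Rightarrow>\<^sub>0 complex) 1"
  proof
    assume "talg_rel (0 :: 'a list \<Rightarrow>\<^sub>0 complex) 1"
    then have "Poly_Mapping.lookup (0 - 1 :: 'a list \<Rightarrow>\<^sub>0 complex) [] = 0"
      unfolding talg_rel_def by (rule lookup_talg_null)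
    then show False
      unfolding lookup_minus zero_list_def[symmetric] lookup_one_zero lookup_zero by simp
  qed
  then show "(0 :: 'a talg) \<noteq> 1" by transfer
qed

end

instantiation talg :: (complex_vs) complex_vs
begin

lift_definition scaleC_talg :: "complex \<Rightarrow> 'a talg \<Rightarrow> 'a talg" is scaleC
  by (rule talg_rel_scale)

instance
proof
  fix a b :: complex and x y :: "'a talg"
  show "a *\<^sub>C (x + y) = a *\<^sub>C x + a *\<^sub>C y"
    by transfer (simp only: scaleC_add_right talg_rel_refl)
  show "(a + b) *\<^sub>C x = a *\<^sub>C x + b *\<^sub>C x"
    by transfer (simp only: scaleC_add_left talg_rel_refl)
  show "a *\<^sub>C (b *\<^sub>C x) = (a * b) *\<^sub>C x"
    by transfer (simp only: scaleC_scaleC talg_rel_refl)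
  show "1 *\<^sub>C x = x"
    by transfer (simp only: scaleC_one talg_rel_refl)
qed

end

lift_definition talg_gen :: "'a::complex_vs \<Rightarrow> 'a talg" is "\<lambda>x. Poly_Mapping.single [x] 1" .

lemma clinear_talg_gen: "clinear talg_gen"
proof -
  have "talg_gen (x + y) = talg_gen x + talg_gen y" for x y :: 'a
    by transfer (simp only: talg_rel_def talg_null_def diff_diff_eq[symmetric],
        rule two_sided_ideal.gen, blast)
  moreover have "talg_gen (c *\<^sub>C x) = c *\<^sub>C talg_gen x" for c and x :: 'a
    by transfer (simp only: scaleC_eq_mult mult_single add_0 mult_1_right talg_rel_def talg_null_def,
        rule two_sided_ideal.gen, blast)
  ultimately show ?thesis by (simp add: clinear_iff)
qed

definition uea_ideal :: "('l::complex_vs \<Rightarrow> 'l \<Rightarrow> 'l) \<Rightarrow> 'l talg set"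
  where "uea_ideal br = two_sided_ideal
           {talg_gen x * talg_gen y - talg_gen y * talg_gen x - talg_gen (br x y) | x y. True}"

text \<open>The universal enveloping algebra of a Lie algebra \<open>L\<close> is the tensor algebra of \<open>L\<close> modulo
  \<^const>\<open>uea_ideal\<close>.  Subspaces of it, and quotients of such subspaces, are described below by
  their preimages in the tensor algebra.\<close>

inductive_set subalgebra :: "('r::{ring_1,complex_vs}) set \<Rightarrow> 'r set" for S where
  one: "1 \<in> subalgebra S"
| gen: "x \<in> S \<Longrightarrow> x \<in> subalgebra S"
| add: "x \<in> subalgebra S \<Longrightarrow> y \<in> subalgebra S \<Longrightarrow> x + y \<in> subalgebra S"
| scale: "x \<in> subalgebra S \<Longrightarrow> c *\<^sub>C x \<in> subalgebra S"
| mult: "x \<in> subalgebra S \<Longrightarrow> y \<in> subalgebra S \<Longrightarrow> x * y \<in> subalgebra S"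

section \<open>Lie algebras, modules and cohomology\<close>

locale lie_algebra =
  fixes br :: "'g::complex_vs \<Rightarrow> 'g \<Rightarrow> 'g"
  assumes cbilinear_br: "cbilinear br"
    and br_self: "br x x = 0"
    and jacobi: "br x (br y z) + br y (br z x) + br z (br x y) = 0"

locale lie_module = lie_algebra br
  for br :: "'g::complex_vs \<Rightarrow> 'g \<Rightarrow> 'g" +
  fixes act :: "'g \<Rightarrow> 'v::complex_vs \<Rightarrow> 'v"
  assumes cbilinear_act: "cbilinear act"
    and act_br: "act (br x y) v = act x (act y v) - act y (act x v)"

definition lie_module_hom ::
    "('g \<Rightarrow> 'v::complex_vs \<Rightarrow> 'v) \<Rightarrow> ('g \<Rightarrow> 'w::complex_vs \<Rightarrow> 'w) \<Rightarrow> ('v \<Rightarrow> 'w) \<Rightarrow> bool"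
  where "lie_module_hom act act' f \<longleftrightarrow> clinear f \<and> (\<forall>x v. f (act x v) = act' x (f v))"

definition lie_ideal :: "('g::complex_vs \<Rightarrow> 'g \<Rightarrow> 'g) \<Rightarrow> 'g set \<Rightarrow> bool"
  where "lie_ideal br I \<longleftrightarrow> cvs.subspace I \<and> (\<forall>x. \<forall>y\<in>I. br x y \<in> I)"

definition derived_subalgebra :: "('g::complex_vs \<Rightarrow> 'g \<Rightarrow> 'g) \<Rightarrow> 'g set \<Rightarrow> 'g set"
  where "derived_subalgebra br I = cvs.span {br x y | x y. x \<in> I \<and> y \<in> I}"

definition lie_solvable :: "('g::complex_vs \<Rightarrow> 'g \<Rightarrow> 'g) \<Rightarrow> 'g set \<Rightarrow> bool"
  where "lie_solvable br I \<longleftrightarrow> (\<exists>n. (derived_subalgebra br ^^ n) I = {0})"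

text \<open>A finite-dimensional Lie algebra is semisimple if it has no nonzero solvable ideal.\<close>

definition semisimple :: "('g::complex_vs \<Rightarrow> 'g \<Rightarrow> 'g) \<Rightarrow> bool"
  where "semisimple br \<longleftrightarrow> lie_algebra br \<and> finite_dim TYPE('g)
           \<and> (\<forall>I. lie_ideal br I \<and> lie_solvable br I \<longrightarrow> I = {0})"

definition killing :: "('g::complex_vs \<Rightarrow> 'g \<Rightarrow> 'g) \<Rightarrow> 'g \<Rightarrow> 'g \<Rightarrow> complex"
  where "killing br x y = ctrace (\<lambda>z. br x (br y z))"

definition cartan_cocycle :: "('g::complex_vs \<Rightarrow> 'g \<Rightarrow> 'g) \<Rightarrow> 'g \<Rightarrow> 'g \<Rightarrow> 'g \<Rightarrow> complex"
  where "cartan_cocycle br x y z = killing br (br x y) z"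

definition killing_dual_bases ::
    "('g::complex_vs \<Rightarrow> 'g \<Rightarrow> 'g) \<Rightarrow> 'i set \<Rightarrow> ('i \<Rightarrow> 'g) \<Rightarrow> ('i \<Rightarrow> 'g) \<Rightarrow> bool"
  where "killing_dual_bases br J x y \<longleftrightarrow>
           finite J \<and> inj_on x J \<and> cvs.independent (x ` J) \<and> cvs.span (x ` J) = UNIV \<and>
           (\<forall>i\<in>J. \<forall>j\<in>J. killing br (x i) (y j) = (if i = j then 1 else 0))"

definition standard_r_matrix ::
    "'i set \<Rightarrow> ('i \<Rightarrow> 'g::complex_vs) \<Rightarrow> ('i \<Rightarrow> 'g) \<Rightarrow> ('g, 'g) tensor"
  where "standard_r_matrix J x y = (1 / 2) *\<^sub>C (\<Sum>i\<in>J. x i \<otimes> y i + y i \<otimes> x i)"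

text \<open>Chevalley-Eilenberg cochains of degree two and their differential.\<close>

definition alternating2 :: "('g::complex_vs \<Rightarrow> 'g \<Rightarrow> 'v::complex_vs) \<Rightarrow> bool"
  where "alternating2 \<omega> \<longleftrightarrow> cbilinear \<omega> \<and> (\<forall>x. \<omega> x x = 0)"

definition ce_diff2 ::
    "('g \<Rightarrow> 'g \<Rightarrow> 'g) \<Rightarrow> ('g \<Rightarrow> 'v::complex_vs \<Rightarrow> 'v) \<Rightarrow> ('g \<Rightarrow> 'g \<Rightarrow> 'v) \<Rightarrow> 'g \<Rightarrow> 'g \<Rightarrow> 'g \<Rightarrow> 'v"
  where "ce_diff2 br act \<omega> x y z =
           act x (\<omega> y z) - act y (\<omega> x z) + act z (\<omega> x y)
           - \<omega> (br x y) z + \<omega> (br x z) y - \<omega> (br y z) x"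

definition cocycle2 ::
    "('g::complex_vs \<Rightarrow> 'g \<Rightarrow> 'g) \<Rightarrow> ('g \<Rightarrow> 'v::complex_vs \<Rightarrow> 'v) \<Rightarrow> ('g \<Rightarrow> 'g \<Rightarrow> 'v) \<Rightarrow> bool"
  where "cocycle2 br act \<alpha> \<longleftrightarrow> alternating2 \<alpha> \<and> (\<forall>x y z. ce_diff2 br act \<alpha> x y z = 0)"

abbreviation (input) trivial_act :: "'g \<Rightarrow> 'v::zero \<Rightarrow> 'v"
  where "trivial_act \<equiv> \<lambda>_ _. 0"

definition cohomologous3 ::
    "('g::complex_vs \<Rightarrow> 'g \<Rightarrow> 'g) \<Rightarrow> ('g \<Rightarrow> 'v::complex_vs \<Rightarrow> 'v) \<Rightarrow>
     ('g \<Rightarrow> 'g \<Rightarrow> 'g \<Rightarrow> 'v) \<Rightarrow> ('g \<Rightarrow> 'g \<Rightarrow> 'g \<Rightarrow> 'v) \<Rightarrow> bool"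
  where "cohomologous3 br act \<gamma> \<gamma>' \<longleftrightarrow>
           (\<exists>\<eta>. alternating2 \<eta> \<and> (\<forall>x y z. \<gamma> x y z - \<gamma>' x y z = ce_diff2 br act \<eta> x y z))"

text \<open>For a short exact sequence of modules with maps \<open>i\<close> and \<open>d\<close>, the class of \<open>\<alpha>\<close> is sent to the class of \<open>\<gamma>\<close> by the connecting homomorphism: lift \<open>\<alpha>\<close> along
  \<open>d\<close> to a cochain, take its differential, and pull back along \<open>i\<close>.\<close>

definition connecting_hom ::
    "('g::complex_vs \<Rightarrow> 'g \<Rightarrow> 'g) \<Rightarrow> ('g \<Rightarrow> 'u::complex_vs \<Rightarrow> 'u) \<Rightarrow> ('g \<Rightarrow> 'v::complex_vs \<Rightarrow> 'v) \<Rightarrow>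
     ('u \<Rightarrow> 'v) \<Rightarrow> ('v \<Rightarrow> 'w) \<Rightarrow> ('g \<Rightarrow> 'g \<Rightarrow> 'w) \<Rightarrow> ('g \<Rightarrow> 'g \<Rightarrow> 'g \<Rightarrow> 'u) \<Rightarrow> bool"
  where "connecting_hom br act1 act2 i d \<alpha> \<gamma> \<longleftrightarrow>
           (\<exists>\<omega> \<gamma>'. alternating2 \<omega> \<and> (\<forall>x y. d (\<omega> x y) = \<alpha> x y) \<and>
              (\<forall>x y z. ce_diff2 br act2 \<omega> x y z = i (\<gamma>' x y z)) \<and> cohomologous3 br act1 \<gamma>' \<gamma>)"

section \<open>Crossed modules and quasi-invariant tensors\<close>

locale crossed_module =
  m: lie_algebra brm + n: lie_algebra brn + act: lie_module brn act
  for brm :: "'m::complex_vs \<Rightarrow> 'm \<Rightarrow> 'm"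
    and brn :: "'n::complex_vs \<Rightarrow> 'n \<Rightarrow> 'n"
    and act :: "'n \<Rightarrow> 'm \<Rightarrow> 'm" +
  fixes \<mu> :: "'m \<Rightarrow> 'n"
  assumes clinear_mu: "clinear \<mu>"
    and mu_br: "\<mu> (brm u v) = brn (\<mu> u) (\<mu> v)"
    and act_derivation: "act X (brm u v) = brm (act X u) v + brm u (act X v)"
    and mu_act: "\<mu> (act X u) = brn X (\<mu> u)"
    and peiffer: "act (\<mu> u) v = brm u v"

definition semidirect_br ::
    "('m::complex_vs \<Rightarrow> 'm \<Rightarrow> 'm) \<Rightarrow> ('n \<Rightarrow> 'n \<Rightarrow> 'n) \<Rightarrow> ('n \<Rightarrow> 'm \<Rightarrow> 'm) \<Rightarrow>
     'm \<times> 'n \<Rightarrow> 'm \<times> 'n \<Rightarrow> 'm \<times> 'n"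
  where "semidirect_br brm brn act =
           (\<lambda>(u, X) (v, Y). (brm u v + act X v - act Y u, brn X Y))"

definition sum_br :: "('l \<Rightarrow> 'l \<Rightarrow> 'l) \<Rightarrow> 'l \<times> 'l \<Rightarrow> 'l \<times> 'l \<Rightarrow> 'l \<times> 'l"
  where "sum_br br = (\<lambda>(a, b) (a', b'). (br a a', br b b'))"

text \<open>With \<open>\<ee> = \<mm> \<rtimes> \<nn>\<close>, realised on pairs, the generators of \<open>U(\<ee> \<oplus> \<ee>)\<close> coming from
  \<open>\<nn> \<oplus> \<nn>\<close> and from \<open>\<mm> \<oplus> \<mm>\<close>.  Under \<open>U(\<ee> \<oplus> \<ee>) = U(\<ee>) \<otimes> U(\<ee>)\<close> the element
  \<open>x \<otimes> y\<close> for \<open>x, y \<in> \<ee>\<close> is the product of the generators \<open>(x, 0)\<close> and \<open>(0, y)\<close>.\<close>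

definition n_gen :: "'n::complex_vs \<times> 'n \<Rightarrow> (('m::complex_vs \<times> 'n) \<times> ('m \<times> 'n)) talg"
  where "n_gen = (\<lambda>(X, Y). talg_gen ((0, X), (0, Y)))"

definition m_gen :: "'m::complex_vs \<times> 'm \<Rightarrow> (('m \<times> 'n::complex_vs) \<times> ('m \<times> 'n)) talg"
  where "m_gen = (\<lambda>(u, v). talg_gen ((u, 0), (v, 0)))"

definition Un2 :: "(('m::complex_vs \<times> 'n::complex_vs) \<times> ('m \<times> 'n)) talg set"
  where "Un2 = subalgebra (range n_gen)"

definition A2 ::
    "('m::complex_vs \<Rightarrow> 'm \<Rightarrow> 'm) \<Rightarrow> ('n::complex_vs \<Rightarrow> 'n \<Rightarrow> 'n) \<Rightarrow> ('n \<Rightarrow> 'm \<Rightarrow> 'm) \<Rightarrow>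
     (('m \<times> 'n) \<times> ('m \<times> 'n)) talg set"
  where "A2 brm brn act = cvs.span
           (uea_ideal (sum_br (semidirect_br brm brn act))
            \<union> {x * m_gen v * y | x v y. x \<in> Un2 \<and> y \<in> Un2})"

definition U2_null ::
    "('m::complex_vs \<Rightarrow> 'm \<Rightarrow> 'm) \<Rightarrow> ('n::complex_vs \<Rightarrow> 'n \<Rightarrow> 'n) \<Rightarrow> ('n \<Rightarrow> 'm \<Rightarrow> 'm) \<Rightarrow> ('m \<Rightarrow> 'n) \<Rightarrow>
     (('m \<times> 'n) \<times> ('m \<times> 'n)) talg set"
  where "U2_null brm brn act \<mu> = cvs.span
           (uea_ideal (sum_br (semidirect_br brm brn act))
            \<union> {x * n_gen (map_prod \<mu> \<mu> u) * y * m_gen v * z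
                - x * m_gen u * y * n_gen (map_prod \<mu> \<mu> v) * z
               | x u y v z. x \<in> Un2 \<and> y \<in> Un2 \<and> z \<in> Un2})"

text \<open>Equality of the elements represented by \<open>p\<close> and \<open>q\<close> in \<open>\<U>\<^sup>(\<^sup>2\<^sup>)\<close>, the quotient of
  \<^const>\<open>A2\<close> by \<^const>\<open>U2_null\<close>.\<close>

definition U2_eq ::
    "('m::complex_vs \<Rightarrow> 'm \<Rightarrow> 'm) \<Rightarrow> ('n::complex_vs \<Rightarrow> 'n \<Rightarrow> 'n) \<Rightarrow> ('n \<Rightarrow> 'm \<Rightarrow> 'm) \<Rightarrow> ('m \<Rightarrow> 'n) \<Rightarrow>
     (('m \<times> 'n) \<times> ('m \<times> 'n)) talg \<Rightarrow> (('m \<times> 'n) \<times> ('m \<times> 'n)) talg \<Rightarrow> bool"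
  where "U2_eq brm brn act \<mu> p q \<longleftrightarrow>
           p \<in> A2 brm brn act \<and> q \<in> A2 brm brn act \<and> p - q \<in> U2_null brm brn act \<mu>"

text \<open>The space \<open>(\<nn> \<otimes> \<mm>) \<oplus> (\<mm> \<otimes> \<nn>)\<close> and its canonical map to \<open>U(\<ee> \<oplus> \<ee>)\<close>.\<close>

type_synonym ('n, 'm) mixed = "('n, 'm) tensor \<times> ('m, 'n) tensor"

definition mixed_embed ::
    "('n::complex_vs, 'm::complex_vs) mixed \<Rightarrow> (('m \<times> 'n) \<times> ('m \<times> 'n)) talg"
  where "mixed_embed = (\<lambda>(s, t).
           tensor_lift (\<lambda>X v. n_gen (X, 0) * m_gen (0, v)) s
           + tensor_lift (\<lambda>v X. m_gen (v, 0) * n_gen (0, X)) t)"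

definition mixed_flip :: "('n::complex_vs, 'm::complex_vs) mixed \<Rightarrow> ('n, 'm) mixed"
  where "mixed_flip = (\<lambda>(s, t). (tensor_flip t, tensor_flip s))"

text \<open>The map induced by \<open>\<beta> : \<ee> \<rightarrow> \<nn>\<close>, which is \<open>\<mu>\<close> on \<open>\<mm>\<close> and the identity on \<open>\<nn>\<close>.\<close>

definition mixed_beta ::
    "('m \<Rightarrow> 'n) \<Rightarrow> ('n::complex_vs, 'm::complex_vs) mixed \<Rightarrow> ('n, 'n) tensor"
  where "mixed_beta \<mu> = (\<lambda>(s, t).
           tensor_lift (\<lambda>X v. X \<otimes> \<mu> v) s + tensor_lift (\<lambda>v X. \<mu> v \<otimes> X) t)"

definition tensor_act ::
    "('n \<Rightarrow> 'a::complex_vs \<Rightarrow> 'a) \<Rightarrow> ('n \<Rightarrow> 'b::complex_vs \<Rightarrow> 'b) \<Rightarrow> 'n \<Rightarrow> ('a, 'b) tensor \<Rightarrow> ('a, 'b) tensor"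
  where "tensor_act acta actb X = tensor_lift (\<lambda>a b. acta X a \<otimes> b + a \<otimes> actb X b)"

definition mixed_act ::
    "('n::complex_vs \<Rightarrow> 'n \<Rightarrow> 'n) \<Rightarrow> ('n \<Rightarrow> 'm::complex_vs \<Rightarrow> 'm) \<Rightarrow> 'n \<Rightarrow> ('n, 'm) mixed \<Rightarrow> ('n, 'm) mixed"
  where "mixed_act brn act X = (\<lambda>(s, t). (tensor_act brn act X s, tensor_act act brn X t))"

text \<open>\<open>u \<cdot> r = - \<Sum>\<^sub>i ((s\<^sub>i \<cdot> u) \<otimes> t\<^sub>i + s\<^sub>i \<otimes> (t\<^sub>i \<cdot> u))\<close> for \<open>r = \<Sum>\<^sub>i s\<^sub>i \<otimes> t\<^sub>i\<close>.\<close>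

definition m_act ::
    "('n::complex_vs \<Rightarrow> 'm::complex_vs \<Rightarrow> 'm) \<Rightarrow> 'm \<Rightarrow> ('n, 'n) tensor \<Rightarrow> ('n, 'm) mixed"
  where "m_act act u r =
           - (tensor_lift (\<lambda>s t. s \<otimes> act t u) r, tensor_lift (\<lambda>s t. act s u \<otimes> t) r)"

locale quasi_invariant_tensor = crossed_module brm brn act \<mu>
  for brm :: "'m::complex_vs \<Rightarrow> 'm \<Rightarrow> 'm"
    and brn :: "'n::complex_vs \<Rightarrow> 'n \<Rightarrow> 'n"
    and act :: "'n \<Rightarrow> 'm \<Rightarrow> 'm"
    and \<mu> :: "'m \<Rightarrow> 'n" +
  fixes r :: "('n, 'n) tensor"
    and \<xi> :: "'n \<Rightarrow> ('n, 'm) mixed"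
    and c :: 'm
  assumes r_symmetric: "tensor_flip r = r"
    and clinear_xi: "clinear \<xi>"
    and xi_flip: "mixed_flip (\<xi> X) = \<xi> X"
    and mu_c: "\<mu> c = 0"
    and c_invariant: "act X c = 0"
    and act_r: "tensor_act brn brn X r = mixed_beta \<mu> (\<xi> X)"
    and m_act_r: "U2_eq brm brn act \<mu> (mixed_embed (m_act act u r)) (mixed_embed (\<xi> (\<mu> u)))"
    and xi_br: "U2_eq brm brn act \<mu> (mixed_embed (\<xi> (brn X Y)))
                  (mixed_embed (mixed_act brn act X (\<xi> Y) - mixed_act brn act Y (\<xi> X)))"

section \<open>Abelian representatives\<close>

definition abelian_ext_br ::
    "('g \<Rightarrow> 'g \<Rightarrow> 'g) \<Rightarrow> ('g \<Rightarrow> 'w::complex_vs \<Rightarrow> 'w) \<Rightarrow> ('g \<Rightarrow> 'g \<Rightarrow> 'w) \<Rightarrow>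
     'w \<times> 'g \<Rightarrow> 'w \<times> 'g \<Rightarrow> 'w \<times> 'g"
  where "abelian_ext_br br act3 \<alpha> =
           (\<lambda>(h, X) (h', Y). (act3 X h' - act3 Y h + \<alpha> X Y, br X Y))"

definition abelian_ext_act :: "('g \<Rightarrow> 'v \<Rightarrow> 'v) \<Rightarrow> 'w \<times> 'g \<Rightarrow> 'v \<Rightarrow> 'v"
  where "abelian_ext_act act2 = (\<lambda>(h, X). act2 X)"

definition abelian_mu :: "('v \<Rightarrow> 'w) \<Rightarrow> 'v \<Rightarrow> 'w \<times> 'g::zero"
  where "abelian_mu d v = (d v, 0)"

text \<open>The data \<open>0 \<rightarrow> \<complex> \<rightarrow> V\<^sub>2 \<rightarrow> V\<^sub>3 \<rightarrow> 0\<close> and \<open>\<alpha>\<close> define an abelian representative of the class of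
  the 3-cocycle \<open>\<gamma>\<close>.\<close>

locale abelian_representative =
  lie_algebra br + V2: lie_module br act2 + V3: lie_module br act3
  for br :: "'g::complex_vs \<Rightarrow> 'g \<Rightarrow> 'g"
    and act2 :: "'g \<Rightarrow> 'v::complex_vs \<Rightarrow> 'v"
    and act3 :: "'g \<Rightarrow> 'w::complex_vs \<Rightarrow> 'w" +
  fixes i :: "complex \<Rightarrow> 'v" and d :: "'v \<Rightarrow> 'w"
    and \<alpha> :: "'g \<Rightarrow> 'g \<Rightarrow> 'w"
    and \<gamma> :: "'g \<Rightarrow> 'g \<Rightarrow> 'g \<Rightarrow> complex"
  assumes hom_i: "lie_module_hom trivial_act act2 i"
    and hom_d: "lie_module_hom act2 act3 d"
    and inj_i: "inj i"
    and exact: "range i = {v. d v = 0}"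
    and surj_d: "surj d"
    and cocycle_alpha: "cocycle2 br act3 \<alpha>"
    and class_alpha: "connecting_hom br trivial_act act2 i d \<alpha> \<gamma>"

text \<open>The maps \<open>\<xi>\<^sub>0\<close> and \<open>C\<close>, for \<open>r = \<Sum>\<^sub>k\<^sub>\<in>\<^sub>I s\<^sub>k \<otimes> t\<^sub>k\<close>, with \<open>(h, X)\<close> written as \<open>(0, X) + (h, 0)\<close>.\<close>

definition xi0 ::
    "('g::complex_vs \<Rightarrow> 'v::complex_vs \<Rightarrow> 'v) \<Rightarrow> ('w::complex_vs \<Rightarrow> 'v) \<Rightarrow> ('g \<Rightarrow> 'g \<Rightarrow> 'v) \<Rightarrow>
     'k set \<Rightarrow> ('k \<Rightarrow> 'g) \<Rightarrow> ('k \<Rightarrow> 'g) \<Rightarrow> 'w \<times> 'g \<Rightarrow> ('w \<times> 'g, 'v) mixed"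
  where "xi0 act2 Q \<omega> I s t = (\<lambda>(h, X).
           (\<Sum>k\<in>I. ((0, s k) \<otimes> \<omega> (t k) X, \<omega> (s k) X \<otimes> (0, t k)))
           + (\<Sum>k\<in>I. ((0, s k) \<otimes> act2 (t k) (Q h), act2 (s k) (Q h) \<otimes> (0, t k))))"

definition Cmap :: "'v::complex_vs \<Rightarrow> 'w::complex_vs \<times> 'g::complex_vs \<Rightarrow> ('w \<times> 'g, 'v) mixed"
  where "Cmap one = (\<lambda>(h, X). ((0, X) \<otimes> one, one \<otimes> (0, X)))"

end

theory Submission
  imports Defs
begin

text \<open>For \<open>e = (h, X)\<close> in \<open>E\<close> put \<open>\<zeta>(e, a) = \<omega>(a, X) + a \<cdot> Q(h)\<close>.  Then
  \<open>\<xi>\<^sub>0(e)\<close> is the standard r-matrix with \<open>\<zeta>(e)\<close> applied to either leg, and in \<open>E\<close>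
  the bracket of \<open>e\<close> with the lift of \<open>a\<close> is the lift of \<open>[X, a]\<close> minus \<open>\<mu>(\<zeta>(e, a))\<close>.
  Hence conditions (a) and (b) follow, already before passing to the quotient, from the invariance
  of the r-matrix and from the triviality of the action on \<open>ker d\<close>.  In (c) the differential of
  \<open>\<xi>\<^sub>0\<close> is a sum of two kinds of terms.  Those with a leg in \<open>\<mu>(V\<^sub>2)\<close> cancel through
  \<open>\<mu>(u) \<otimes> v = u \<otimes> \<mu>(v)\<close>.  The others combine to the differential of \<open>\<omega>\<close>, that is
  to the Cartan cocycle, in one leg; since the r-matrix is inverse to the Killing form this equals
  \<open>- C([e, f])\<close> modulo the same relations, which is what \<open>C\<close> compensates for.\<close>

section \<open>Linear and bilinear maps, and induction on tensors\<close>

lemma clinear_add: "clinear f \<Longrightarrow> f (x + y) = f x + f y"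
  and clinear_scale: "clinear f \<Longrightarrow> f (c *\<^sub>C x) = c *\<^sub>C f x"
  by (simp_all add: clinear_iff)

lemma clinear_zero: "clinear f \<Longrightarrow> f 0 = 0"
  by (metis add_cancel_right_right clinear_add)

lemma clinear_minus: "clinear f \<Longrightarrow> f (- x) = - f x"
  by (metis add_eq_0_iff clinear_add clinear_zero)

lemma clinear_diff: "clinear f \<Longrightarrow> f (x - y) = f x - f y"
  by (metis clinear_add clinear_minus diff_conv_add_uminus)

lemma clinear_sum: "clinear f \<Longrightarrow> f (\<Sum>k\<in>K. g k) = (\<Sum>k\<in>K. f (g k))"
  by (induction K rule: infinite_finite_induct) (simp_all add: clinear_zero clinear_add)

lemmas clinear_simps = clinear_add clinear_scale clinear_zero clinear_minus clinear_diff clinear_sum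

lemma cbilinear_iff:
  "cbilinear f \<longleftrightarrow> (\<forall>x x' y. f (x + x') y = f x y + f x' y) \<and> (\<forall>c x y. f (c *\<^sub>C x) y = c *\<^sub>C f x y)
     \<and> (\<forall>x y y'. f x (y + y') = f x y + f x y') \<and> (\<forall>c x y. f x (c *\<^sub>C y) = c *\<^sub>C f x y)"
  by (auto simp: cbilinear_def clinear_iff)

lemma cbilinear_left: "cbilinear f \<Longrightarrow> clinear (\<lambda>x. f x y)"
  and cbilinear_right: "cbilinear f \<Longrightarrow> clinear (f x)"
  by (simp_all add: cbilinear_def)

lemmas cbilinear_simps = cbilinear_left[THEN clinear_add] cbilinear_left[THEN clinear_scale]
  cbilinear_left[THEN clinear_zero] cbilinear_left[THEN clinear_minus]
  cbilinear_left[THEN clinear_diff] cbilinear_left[THEN clinear_sum]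
  cbilinear_right[THEN clinear_add] cbilinear_right[THEN clinear_scale]
  cbilinear_right[THEN clinear_zero] cbilinear_right[THEN clinear_minus]
  cbilinear_right[THEN clinear_diff] cbilinear_right[THEN clinear_sum]

lemmas tensor_simps = cbilinear_simps[OF cbilinear_tensor]

lemma scaleC_Pair: "c *\<^sub>C (x, y) = (c *\<^sub>C x, c *\<^sub>C y)"
  by (simp add: scaleC_prod_def)

lemma cbilinear_comp:
  "cbilinear f \<Longrightarrow> clinear g \<Longrightarrow> clinear h \<Longrightarrow> cbilinear (\<lambda>x y. f (g x) (h y))"
  by (simp add: cbilinear_iff clinear_iff)

lemma cbilinear_swap: "cbilinear f \<Longrightarrow> cbilinear (\<lambda>x y. f y x)"
  by (simp add: cbilinear_def)

lemma cbilinear_plus: "cbilinear f \<Longrightarrow> cbilinear g \<Longrightarrow> cbilinear (\<lambda>x y. f x y + g x y)"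
  by (simp add: cbilinear_iff scaleC_add_right algebra_simps)

lemma clinear_ident: "clinear (\<lambda>x. x)"
  by (simp add: clinear_iff)

lemma tensor_lift_sum:
  assumes "cbilinear f"
  shows "tensor_lift f (\<Sum>k\<in>K. a k \<otimes> b k) = (\<Sum>k\<in>K. f (a k) (b k))"
  by (simp add: clinear_sum[OF clinear_tensor_lift[OF assms]] tensor_lift_tensor[OF assms])

text \<open>A representative is a finitely supported function on pairs, built up one entry at a
  time, and a single entry is a scalar multiple of a pure tensor. Zero needs no case of its own
  because it is \<open>0 *\<^sub>C (0 \<otimes> 0)\<close>.\<close>

lemma tensor_induct [case_names tensor add scale]:
  fixes p :: "('a::complex_vs, 'b::complex_vs) tensor"
  assumes "\<And>x y. P (x \<otimes> y)" and "\<And>p q. P p \<Longrightarrow> P q \<Longrightarrow> P (p + q)"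
    and "\<And>c p. P p \<Longrightarrow> P (c *\<^sub>C p)"
  shows "P p"
proof (induction p rule: tensor.abs_induct)
  case (1 p)
  have zero: "P 0" using assms(3)[OF assms(1), of 0 0 0] by simp
  have single: "P (abs_tensor (Poly_Mapping.single k c))" for k c
  proof -
    have "Poly_Mapping.single k c = c *\<^sub>C Poly_Mapping.single k 1"
      by (rule poly_mapping_eqI)
        (simp add: scaleC_poly_mapping.rep_eq lookup_single scaleC_complex_def when_def)
    then have "abs_tensor (Poly_Mapping.single k c) = c *\<^sub>C (fst k \<otimes> snd k)"
      by (simp add: tensor.abs_eq scaleC_tensor.abs_eq)
    then show ?thesis using assms(1,3) by simp
  qed
  show ?case
  proof (induction p rule: Poly_Mapping.update_induct)
    case (update p k c)
    then have "Poly_Mapping.update k c p = p + Poly_Mapping.single k c"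
      by (intro poly_mapping_eqI) (auto simp: lookup_update lookup_add lookup_single in_keys_iff when_def)
    with update single assms(2) show ?case
      by (simp add: plus_tensor.abs_eq[symmetric])
  qed (simp add: zero zero_tensor_def[symmetric])
qed

text \<open>Polarisation: expand \<open>\<omega> (x + y) (x + y)\<close>.\<close>

lemma alternating2_anti:
  assumes "alternating2 \<omega>"
  shows "\<omega> x y = - \<omega> y x"
proof -
  have "cbilinear \<omega>" "\<And>z. \<omega> z z = 0"
    using assms by (simp_all add: alternating2_def)
  then have "\<omega> x y + \<omega> y x = \<omega> (x + y) (x + y)"
    unfolding cbilinear_simps(1,7)[OF \<open>cbilinear \<omega>\<close>] by simp
  also have "\<dots> = 0"
    by fact
  finally show ?thesis by (simp only: eq_neg_iff_add_eq_0)
qed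

section \<open>The Killing form\<close>

text \<open>Exposes the basis hidden in the choice operator of \<open>ctrace\<close>. One basis
  serves all \<open>f\<close>, so identities between traces reduce to identities between matrix
  entries.\<close>

lemma basis_for_ctrace:
  assumes "finite_dim TYPE('a::complex_vs)"
  obtains B :: "'a::complex_vs set" where "finite B" "cvs.independent B" "cvs.span B = UNIV"
    "\<And>f. ctrace f = (\<Sum>b\<in>B. cvs.representation B (f b) b)"
proof -
  define B :: "'a set" where "B = (SOME B. cvs.independent B \<and> cvs.span B = UNIV)"
  obtain B0 :: "'a set" where "cvs.independent B0" "UNIV \<subseteq> cvs.span B0"
    by (rule cvs.basis_exists[of UNIV])
  then have "cvs.independent B0 \<and> cvs.span B0 = UNIV"
    by blast
  then have B: "cvs.independent B \<and> cvs.span B = UNIV"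
    unfolding B_def by (rule someI)
  obtain S :: "'a set" where "finite S" "cvs.span S = UNIV"
    using assms unfolding finite_dim_def by blast
  then have "finite B"
    using cvs.independent_span_bound[of S B] B by blast
  moreover have "ctrace f = (\<Sum>b\<in>B. cvs.representation B (f b) b)" for f :: "'a \<Rightarrow> 'a"
    unfolding ctrace_def B_def Let_def ..
  ultimately show ?thesis
    using B by (intro that) simp_all
qed

text \<open>The action of the matrix of \<open>f\<close> on coordinates; at \<open>v = g b\<close>
  it gives the entries of a matrix product.\<close>

lemma representation_clinear:
  fixes f :: "'a::complex_vs \<Rightarrow> 'a"
  assumes "clinear f" "finite B" "cvs.independent B" "cvs.span B = UNIV"
  shows "cvs.representation B (f v) b
    = (\<Sum>b'\<in>B. cvs.representation B v b' * cvs.representation B (f b') b)"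
proof -
  have "(\<Sum>b'\<in>B. cvs.representation B v b' *\<^sub>C b') = v"
    using cvs.sum_representation_eq[of B v B] assms by simp
  then have "f v = f (\<Sum>b'\<in>B. cvs.representation B v b' *\<^sub>C b')"
    by (simp only:)
  also have "\<dots> = (\<Sum>b'\<in>B. cvs.representation B v b' *\<^sub>C f b')"
    by (simp only: clinear_sum[OF assms(1)] clinear_scale[OF assms(1)])
  finally show ?thesis
    using assms by (simp add: cvs.representation_sum cvs.representation_scale)
qed

lemma ctrace_commute:
  fixes f g :: "'a::complex_vs \<Rightarrow> 'a"
  assumes "finite_dim TYPE('a)" "clinear f" "clinear g"
  shows "ctrace (\<lambda>z. f (g z)) = ctrace (\<lambda>z. g (f z))"
proof -
  obtain B :: "'a set" where B: "finite B" "cvs.independent B" "cvs.span B = UNIV"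
    and tr: "\<And>f. ctrace f = (\<Sum>b\<in>B. cvs.representation B (f b) b)"
    by (rule basis_for_ctrace[OF assms(1)], rule that)
  have "ctrace (\<lambda>z. f (g z))
      = (\<Sum>b\<in>B. \<Sum>b'\<in>B. cvs.representation B (g b) b' * cvs.representation B (f b') b)"
    unfolding tr by (intro sum.cong refl representation_clinear[OF assms(2) B])
  also have "\<dots> = (\<Sum>b'\<in>B. \<Sum>b\<in>B. cvs.representation B (f b') b * cvs.representation B (g b) b')"
    by (subst sum.swap) (simp only: mult.commute)
  also have "\<dots> = ctrace (\<lambda>z. g (f z))"
    unfolding tr by (intro sum.cong refl representation_clinear[OF assms(3) B, symmetric])
  finally show ?thesis .
qed

lemma clinear_ctrace:
  fixes f g :: "'a::complex_vs \<Rightarrow> 'a"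
  assumes "finite_dim TYPE('a)"
  shows "ctrace (\<lambda>z. f z + g z) = ctrace f + ctrace g"
    and "ctrace (\<lambda>z. c *\<^sub>C f z) = c * ctrace f"
    and "ctrace (\<lambda>z. f z - g z) = ctrace f - ctrace g"
proof -
  obtain B :: "'a set" where B: "finite B" "cvs.independent B" "cvs.span B = UNIV"
    and tr: "\<And>f. ctrace f = (\<Sum>b\<in>B. cvs.representation B (f b) b)"
    by (rule basis_for_ctrace[OF assms], rule that)
  show "ctrace (\<lambda>z. f z + g z) = ctrace f + ctrace g"
    and "ctrace (\<lambda>z. c *\<^sub>C f z) = c * ctrace f"
    and "ctrace (\<lambda>z. f z - g z) = ctrace f - ctrace g"
    using B by (simp_all add: tr cvs.representation_add cvs.representation_scale
        cvs.representation_diff sum.distrib sum_subtractf sum_distrib_left)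
qed

context lie_algebra
begin

lemmas br_simps = cbilinear_simps[OF cbilinear_br]

lemma br_anti: "br x y = - br y x"
  by (rule alternating2_anti) (simp add: alternating2_def cbilinear_br br_self)

text \<open>The Jacobi identity read as: the adjoint action is a representation. This form expands
  the Killing form of a bracket.\<close>

lemma br_br: "br (br x y) z = br x (br y z) - br y (br x z)"
proof -
  have "br x (br y z) - br y (br x z) + br z (br x y) = 0"
    using jacobi[of x y z] by (simp add: br_anti[of z x] br_simps)
  then show ?thesis
    by (simp add: br_anti[of "br x y" z] algebra_simps)
qed

lemma killing_sym: "finite_dim TYPE('g) \<Longrightarrow> killing br x y = killing br y x"
  unfolding killing_def
  by (rule ctrace_commute[OF _ cbilinear_right[OF cbilinear_br] cbilinear_right[OF cbilinear_br]])

text \<open>Writing ad of a bracket as a commutator turns both sides into differences of traces of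
  triple products. One trace is common, and the others agree by cyclicity.\<close>

lemma killing_invariant:
  assumes "finite_dim TYPE('g)"
  shows "killing br (br x y) z = killing br x (br y z)"
proof -
  note lin = cbilinear_right[OF cbilinear_br]
  have "ctrace (\<lambda>w. br y (br x (br z w))) = ctrace (\<lambda>w. br x (br z (br y w)))"
    using lin by (intro ctrace_commute[OF assms, of "br y" "\<lambda>w. br x (br z w)"])
      (simp_all add: clinear_iff)
  then show ?thesis
    unfolding killing_def br_br br_simps by (simp add: clinear_ctrace[OF assms])
qed

lemma cbilinear_killing: "finite_dim TYPE('g) \<Longrightarrow> cbilinear (killing br)"
  by (simp add: cbilinear_iff killing_def br_simps clinear_ctrace scaleC_complex_def)

end

section \<open>The standard r-matrix\<close>

locale killing_dual = lie_algebra br for br :: "'g::complex_vs \<Rightarrow> 'g \<Rightarrow> 'g" +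
  fixes J :: "'j set" and x y :: "'j \<Rightarrow> 'g"
  assumes fin_dim: "finite_dim TYPE('g)"
    and dual: "killing_dual_bases br J x y"
begin

lemma finite_J: "finite J"
  and dual_delta: "i \<in> J \<Longrightarrow> j \<in> J \<Longrightarrow> killing br (x i) (y j) = (if i = j then 1 else 0)"
  using dual by (simp_all add: killing_dual_bases_def)

lemmas killing_simps = cbilinear_simps[OF cbilinear_killing[OF fin_dim]]

text \<open>The right-hand side is linear in \<open>Z\<close> and fixes every \<open>x i\<close> by
  duality, and the \<open>x i\<close> span.\<close>

lemma expand_x: "Z = (\<Sum>j\<in>J. killing br Z (y j) *\<^sub>C x j)"
proof -
  define E where "E Z = (\<Sum>j\<in>J. killing br Z (y j) *\<^sub>C x j)" for Z
  have "E (x i) = x i" if "i \<in> J" for i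
  proof -
    have "E (x i) = (\<Sum>j\<in>J. if i = j then x j else 0)"
      unfolding E_def using that by (intro sum.cong) (auto simp: dual_delta)
    then show ?thesis using that finite_J by simp
  qed
  moreover have "clinear E"
    by (simp add: clinear_iff E_def killing_simps scaleC_add_left sum.distrib
        cvs.scale_sum_right scaleC_complex_def)
  then have "cvs.subspace {Z. E Z = Z}"
    by (simp add: cvs.subspace_def clinear_simps)
  moreover have "Z \<in> cvs.span (x ` J)"
    using dual by (simp add: killing_dual_bases_def)
  ultimately have "E Z = Z"
    by (elim cvs.span_induct) auto
  then show ?thesis by (simp add: E_def)
qed

text \<open>The dual family forces nondegeneracy: by \<open>expand_x\<close>, \<open>Z\<close> is
  orthogonal to every \<open>W\<close>, in particular to the \<open>y j\<close>, so its own
  expansion vanishes.\<close>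

lemma killing_nondegenerate:
  assumes "\<And>j. j \<in> J \<Longrightarrow> killing br Z (x j) = 0"
  shows "Z = 0"
proof -
  have "killing br Z W = 0" for W
  proof -
    have "killing br Z W = (\<Sum>j\<in>J. killing br W (y j) *\<^sub>C killing br Z (x j))"
      by (subst (1) expand_x[of W]) (simp only: killing_simps)
    also have "\<dots> = 0"
      using assms by (intro sum.neutral) simp
    finally show ?thesis .
  qed
  then have "(\<Sum>j\<in>J. killing br Z (y j) *\<^sub>C x j) = 0"
    by simp
  then show ?thesis
    by (simp only: expand_x[of Z, symmetric])
qed

lemma expand_y: "Z = (\<Sum>j\<in>J. killing br Z (x j) *\<^sub>C y j)"
proof -
  have "killing br (Z - (\<Sum>j\<in>J. killing br Z (x j) *\<^sub>C y j)) (x i) = 0" if "i \<in> J" for i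
  proof -
    have "killing br (y j) (x i) = (if j = i then 1 else 0)" if "j \<in> J" for j
      using that \<open>i \<in> J\<close> killing_sym[OF fin_dim, of "y j" "x i"] by (simp add: dual_delta)
    then have "(\<Sum>j\<in>J. killing br Z (x j) *\<^sub>C killing br (y j) (x i))
        = (\<Sum>j\<in>J. if j = i then killing br Z (x j) else 0)"
      by (intro sum.cong) (simp_all add: scaleC_complex_def)
    also have "\<dots> = killing br Z (x i)"
      using that finite_J by simp
    finally show ?thesis
      by (simp only: killing_simps right_minus_eq)
  qed
  from killing_nondegenerate[OF this] show ?thesis
    by (simp only: right_minus_eq)
qed

text \<open>Invariance of the canonical element of the dual bases. Expanding the brackets in the
  \<open>x k\<close> and in the \<open>y j\<close> gives two double sums whose coefficients are
  opposite.\<close>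

lemma canonical_invariant:
  assumes "cbilinear f"
  shows "(\<Sum>j\<in>J. f (br X (x j)) (y j)) + (\<Sum>j\<in>J. f (x j) (br X (y j))) = 0"
proof -
  note f_simps = cbilinear_simps[OF assms]
  have "f (br X (x j)) (y j) = (\<Sum>k\<in>J. killing br (br X (x j)) (y k) *\<^sub>C f (x k) (y j))" for j
    by (subst expand_x[of "br X (x j)"]) (simp add: f_simps)
  moreover have "f (x k) (br X (y k))
      = (\<Sum>j\<in>J. - killing br (br X (x j)) (y k) *\<^sub>C f (x k) (y j))" for k
  proof -
    \<comment> \<open>Ad is skew for the Killing form; this is the source of the opposite
      signs.\<close>
    have "killing br (br X (y k)) (x j) = - killing br (br X (x j)) (y k)" for j
    proof -
      have "killing br (br X (y k)) (x j) = - killing br (br (y k) X) (x j)"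
        by (subst br_anti) (simp add: killing_simps)
      then show ?thesis
        by (simp add: killing_invariant[OF fin_dim, of "y k"] killing_sym[OF fin_dim, of "y k"])
    qed
    then show ?thesis
      by (subst expand_y[of "br X (y k)"]) (simp add: f_simps)
  qed
  ultimately have "(\<Sum>j\<in>J. f (br X (x j)) (y j)) + (\<Sum>k\<in>J. f (x k) (br X (y k)))
      = (\<Sum>j\<in>J. \<Sum>k\<in>J. killing br (br X (x j)) (y k) *\<^sub>C f (x k) (y j))
        - (\<Sum>k\<in>J. \<Sum>j\<in>J. killing br (br X (x j)) (y k) *\<^sub>C f (x k) (y j))"
    by (simp add: sum_negf)
  also have "\<dots> = 0"
    by (subst sum.swap) simp
  finally show ?thesis .
qed

context
  fixes K :: "'k set" and s t :: "'k \<Rightarrow> 'g"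
  assumes r: "(\<Sum>k\<in>K. s k \<otimes> t k) = standard_r_matrix J x y"
begin

text \<open>Both sides are the value of \<open>tensor_lift f\<close> at the same tensor. Thus an
  arbitrary decomposition of the r-matrix can be traded for the dual bases.\<close>

lemma sum_standard:
  assumes "cbilinear f"
  shows "(\<Sum>k\<in>K. f (s k) (t k)) = (1/2) *\<^sub>C (\<Sum>j\<in>J. f (x j) (y j) + f (y j) (x j))"
proof -
  have "(\<Sum>k\<in>K. f (s k) (t k)) = tensor_lift f (\<Sum>k\<in>K. s k \<otimes> t k)"
    by (simp add: tensor_lift_sum[OF assms])
  also have "\<dots> = (1/2) *\<^sub>C (\<Sum>j\<in>J. f (x j) (y j) + f (y j) (x j))"
    using clinear_tensor_lift[OF assms]
    by (simp add: r standard_r_matrix_def clinear_simps tensor_lift_tensor[OF assms])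
  finally show ?thesis .
qed

lemma standard_symmetric: "(\<Sum>k\<in>K. t k \<otimes> s k) = (\<Sum>k\<in>K. s k \<otimes> t k)"
  using sum_standard[OF cbilinear_swap[OF cbilinear_tensor]]
  by (simp add: sum_standard[OF cbilinear_tensor] add.commute)

text \<open>The r-matrix is half the sum of the canonical element and its flip, and
  \<open>canonical_invariant\<close> covers both.\<close>

lemma standard_invariant: "(\<Sum>k\<in>K. br X (s k) \<otimes> t k + s k \<otimes> br X (t k)) = 0"
proof -
  have bil: "cbilinear (\<lambda>a b. br X a \<otimes> b + a \<otimes> br X b)"
    by (intro cbilinear_plus cbilinear_comp[OF cbilinear_tensor] clinear_ident
        cbilinear_right[OF cbilinear_br])
  have "(\<Sum>j\<in>J. (br X (x j) \<otimes> y j + x j \<otimes> br X (y j)) + (br X (y j) \<otimes> x j + y j \<otimes> br X (x j))) = 0"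
    using canonical_invariant[OF cbilinear_tensor, of X]
      canonical_invariant[OF cbilinear_swap[OF cbilinear_tensor], of X]
    unfolding sum.distrib by (simp add: add_eq_0_iff2 add.commute)
  then show ?thesis
    by (simp add: sum_standard[OF bil])
qed

text \<open>The r-matrix is inverse to the Killing form: contracting its two halves gives the
  expansions of \<open>Z\<close> in the \<open>y j\<close> and in the \<open>x j\<close>, each with
  weight one half.\<close>

lemma standard_reproducing: "(\<Sum>k\<in>K. killing br Z (s k) *\<^sub>C t k) = Z"
proof -
  have bil: "cbilinear (\<lambda>a b. killing br Z a *\<^sub>C b)"
    by (simp add: cbilinear_iff killing_simps scaleC_complex_def scaleC_add_left scaleC_add_right
        scaleC_scaleC mult.commute)
  have "(\<Sum>k\<in>K. killing br Z (s k) *\<^sub>C t k) = (1/2) *\<^sub>C (Z + Z)"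
    by (simp add: sum_standard[OF bil] sum.distrib expand_x[of Z, symmetric] expand_y[of Z, symmetric])
  also have "Z + Z = 2 *\<^sub>C Z"
    using cvs.scale_left_distrib[of 1 1 Z] by simp
  also have "(1/2) *\<^sub>C 2 *\<^sub>C Z = Z"
    by simp
  finally show ?thesis .
qed

end

end

section \<open>The space of mixed tensors and its image in the enveloping algebra\<close>

lemma talg_scaleC_mult_left: "(c *\<^sub>C a) * b = c *\<^sub>C (a * b)" for a b :: "'a::complex_vs talg"
  by transfer (simp only: scaleC_eq_mult mult.assoc talg_rel_refl)

text \<open>Scaling is left multiplication by a constant supported on the empty word. Pulling a
  scalar out of a right factor requires this constant to be central.\<close>

lemma mult_single_zero:
  fixes p :: "'a list \<Rightarrow>\<^sub>0 complex"
  shows "p * Poly_Mapping.single 0 c = Poly_Mapping.single 0 c * p"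
proof (rule poly_mapping_eqI)
  fix k :: "'a list"
  have "Sum_any (\<lambda>w. Poly_Mapping.lookup (Poly_Mapping.single 0 c) w when k = v + w) = (c when v = k)" for v
  proof -
    have "(Poly_Mapping.lookup (Poly_Mapping.single 0 c) w when k = v + w)
        = ((c when v = k) when w = 0)" for w
      by (cases "w = 0") (auto simp: lookup_single when_def)
    then show ?thesis by simp
  qed
  then have "Poly_Mapping.lookup (p * Poly_Mapping.single 0 c) k = c * Poly_Mapping.lookup p k"
    by (simp add: lookup_mult mult_when mult.commute)
  also have "\<dots> = Poly_Mapping.lookup (Poly_Mapping.single 0 c * p) k"
    by (simp add: scaleC_eq_mult[symmetric] scaleC_poly_mapping.rep_eq scaleC_complex_def)
  finally show "Poly_Mapping.lookup (p * Poly_Mapping.single 0 c) k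
    = Poly_Mapping.lookup (Poly_Mapping.single 0 c * p) k" .
qed

lemma talg_scaleC_mult_right: "a * (c *\<^sub>C b) = c *\<^sub>C (a * b)" for a b :: "'a::complex_vs talg"
proof (transfer fixing: c)
  fix p q :: "'a list \<Rightarrow>\<^sub>0 complex"
  have "p * c *\<^sub>C q = c *\<^sub>C (p * q)"
    by (simp only: scaleC_eq_mult mult.assoc[symmetric] mult_single_zero)
  then show "talg_rel (p * c *\<^sub>C q) (c *\<^sub>C (p * q))" by (simp only: talg_rel_refl)
qed

lemma cbilinear_talg_mult: "cbilinear ((*) :: 'a::complex_vs talg \<Rightarrow> _)"
  by (simp add: cbilinear_iff talg_scaleC_mult_left talg_scaleC_mult_right algebra_simps)

lemma clinear_comp: "clinear f \<Longrightarrow> clinear g \<Longrightarrow> clinear (\<lambda>x. f (g x))"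
  by (simp add: clinear_iff)

lemma clinear_n_gen: "clinear n_gen"
  and clinear_m_gen: "clinear m_gen"
  by (auto simp: clinear_iff n_gen_def m_gen_def scaleC_Pair
      clinear_add[OF clinear_talg_gen, symmetric] clinear_scale[OF clinear_talg_gen, symmetric])

lemma clinear_Pair: "clinear (\<lambda>x. (x, 0))" "clinear (\<lambda>x. (0, x))"
  by (simp_all add: clinear_iff scaleC_Pair)

lemma cbilinear_mixed_embed:
  "cbilinear (\<lambda>X v. n_gen (X, 0) * m_gen (0, v))"
  "cbilinear (\<lambda>v X. m_gen (v, 0) * n_gen (0, X))"
  by (intro cbilinear_comp[OF cbilinear_talg_mult] clinear_comp[OF clinear_n_gen]
      clinear_comp[OF clinear_m_gen] clinear_Pair)+

lemma clinear_mixed_embed: "clinear mixed_embed"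
  by (auto simp: clinear_iff cbilinear_mixed_embed[THEN clinear_tensor_lift, THEN clinear_add]
      cbilinear_mixed_embed[THEN clinear_tensor_lift, THEN clinear_scale] mixed_embed_def scaleC_Pair
      scaleC_add_right split: prod.splits)

text \<open>Supplies the membership demanded by \<open>U2_eq\<close>. A pure tensor gives one
  generator from \<open>n_gen\<close> and one from \<open>m_gen\<close>, with 1 as the outer factor
  on the other side.\<close>

lemma mixed_embed_in_A2:
  fixes p :: "('n::complex_vs, 'm::complex_vs) mixed"
  shows "mixed_embed p \<in> A2 brm brn act"
proof -
  have sub: "cvs.subspace (A2 brm brn act)"
    unfolding A2_def by (rule cvs.subspace_span)
  have gen: "x * m_gen v * y \<in> A2 brm brn act" if "x \<in> Un2" "y \<in> Un2" for x v y
    unfolding A2_def using that by (intro cvs.span_base) blast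
  have 1: "(1 :: (('m \<times> 'n) \<times> 'm \<times> 'n) talg) \<in> Un2"
    and n: "(n_gen e :: (('m \<times> 'n) \<times> 'm \<times> 'n) talg) \<in> Un2" for e
    by (auto simp: Un2_def intro: subalgebra.intros)
  have left: "tensor_lift (\<lambda>X v. n_gen (X, 0) * m_gen (0, v)) a \<in> A2 brm brn act" for a
  proof (induction a rule: tensor_induct)
    case (tensor X v)
    show ?case using gen[OF n[of "(X, 0)"] 1, of "(0, v)"]
      by (simp add: tensor_lift_tensor cbilinear_mixed_embed)
  qed (simp_all add: cbilinear_mixed_embed[THEN clinear_tensor_lift, THEN clinear_add]
      cbilinear_mixed_embed[THEN clinear_tensor_lift, THEN clinear_scale]
      cvs.subspace_add[OF sub] cvs.subspace_scale[OF sub])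
  have right: "tensor_lift (\<lambda>v X. m_gen (v, 0) * n_gen (0, X)) b \<in> A2 brm brn act" for b
  proof (induction b rule: tensor_induct)
    case (tensor v X)
    show ?case using gen[OF 1 n[of "(0, X)"], of "(v, 0)"]
      by (simp add: tensor_lift_tensor cbilinear_mixed_embed)
  qed (simp_all add: cbilinear_mixed_embed[THEN clinear_tensor_lift, THEN clinear_add]
      cbilinear_mixed_embed[THEN clinear_tensor_lift, THEN clinear_scale]
      cvs.subspace_add[OF sub] cvs.subspace_scale[OF sub])
  show ?thesis
    by (cases p) (simp add: mixed_embed_def left right cvs.subspace_add[OF sub])
qed

text \<open>The defining relation of \<open>\<U>\<^sup>(\<^sup>2\<^sup>)\<close> for \<open>(u, 0)\<close>, \<open>(0, v)\<close> and
  \<open>x = y = z = 1\<close>.\<close>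

definition mixed_null :: "('m::complex_vs \<Rightarrow> 'n::complex_vs) \<Rightarrow> 'm \<Rightarrow> 'm \<Rightarrow> ('n, 'm) mixed"
  where "mixed_null \<mu> u v = (\<mu> u \<otimes> v, - (u \<otimes> \<mu> v))"

lemma mixed_embed_null:
  assumes "clinear \<mu>"
  shows "mixed_embed (mixed_null \<mu> u v) \<in> U2_null brm brn act \<mu>"
proof -
  have "mixed_embed (mixed_null \<mu> u v)
      = 1 * n_gen (map_prod \<mu> \<mu> (u, 0)) * 1 * m_gen (0, v) * 1
        - 1 * m_gen (u, 0) * 1 * n_gen (map_prod \<mu> \<mu> (0, v)) * 1"
    by (simp add: mixed_null_def mixed_embed_def tensor_lift_tensor cbilinear_mixed_embed
        cbilinear_mixed_embed[THEN clinear_tensor_lift, THEN clinear_minus] clinear_zero[OF assms])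
  moreover have "1 \<in> Un2"
    by (simp add: Un2_def subalgebra.one)
  ultimately show ?thesis
    unfolding U2_null_def by (intro cvs.span_base) blast
qed

text \<open>Reduces equality in the quotient to a computation with mixed tensors: the preimage of
  \<open>U2_null\<close> under the linear map \<open>mixed_embed\<close> is a subspace containing
  the elementary relations.\<close>

lemma U2_eq_mixed_embed:
  assumes "clinear \<mu>" and "p - q \<in> cvs.span (range (case_prod (mixed_null \<mu>)))"
  shows "U2_eq brm brn act \<mu> (mixed_embed p) (mixed_embed q)"
proof -
  have sub: "cvs.subspace (U2_null brm brn act \<mu>)"
    unfolding U2_null_def by (rule cvs.subspace_span)
  have "cvs.subspace {p. mixed_embed p \<in> U2_null brm brn act \<mu>}"
    by (simp add: cvs.subspace_def clinear_simps[OF clinear_mixed_embed] cvs.subspace_0[OF sub]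
        cvs.subspace_add[OF sub] cvs.subspace_scale[OF sub])
  with assms(2) have "mixed_embed (p - q) \<in> U2_null brm brn act \<mu>"
    using mixed_embed_null[OF assms(1)] by (elim cvs.span_induct) auto
  then show ?thesis
    by (simp add: U2_eq_def mixed_embed_in_A2 clinear_diff[OF clinear_mixed_embed])
qed

section \<open>Abelian representatives\<close>

lemma tensor_act_sum:
  assumes "clinear (acta X)" "clinear (actb X)"
  shows "tensor_act acta actb X (\<Sum>k\<in>K. a k \<otimes> b k)
    = (\<Sum>k\<in>K. acta X (a k) \<otimes> b k + a k \<otimes> actb X (b k))"
  unfolding tensor_act_def
  by (intro tensor_lift_sum cbilinear_plus cbilinear_comp[OF cbilinear_tensor] assms clinear_ident)

lemma clinear_tensor_act:
  assumes "clinear (acta X)" "clinear (actb X)"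
  shows "clinear (tensor_act acta actb X)"
  unfolding tensor_act_def
  by (intro clinear_tensor_lift cbilinear_plus cbilinear_comp[OF cbilinear_tensor] assms clinear_ident)

lemma tensor_flip_tensor: "tensor_flip (a \<otimes> b) = b \<otimes> a"
  and clinear_tensor_flip: "clinear tensor_flip"
  unfolding tensor_flip_def
  by (simp_all add: tensor_lift_tensor clinear_tensor_lift cbilinear_swap[OF cbilinear_tensor])

lemma tensor_flip_sum: "tensor_flip (\<Sum>k\<in>K. a k \<otimes> b k) = (\<Sum>k\<in>K. b k \<otimes> a k)"
  by (simp add: clinear_sum[OF clinear_tensor_flip] tensor_flip_tensor)

lemma sum_Pair: "(\<Sum>k\<in>K. (f k, g k)) = (sum f K, sum g K)"
  by (simp add: prod_eq_iff fst_sum snd_sum)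

text \<open>Isolates the properties of \<gamma> and of the r-matrix on which the argument rests; the
  Killing form enters only on interpretation. The differential of \<open>Q\<close> after \<alpha> is
  required to equal \<gamma> as a cochain, not just up to a coboundary.\<close>

locale abelian_r_matrix = abelian_representative br act2 act3 i d \<alpha> \<gamma>
  for br :: "'g::complex_vs \<Rightarrow> 'g \<Rightarrow> 'g"
    and act2 :: "'g \<Rightarrow> 'v::complex_vs \<Rightarrow> 'v"
    and act3 :: "'g \<Rightarrow> 'w::complex_vs \<Rightarrow> 'w"
    and i :: "complex \<Rightarrow> 'v" and d :: "'v \<Rightarrow> 'w"
    and \<alpha> :: "'g \<Rightarrow> 'g \<Rightarrow> 'w"
    and \<gamma> :: "'g \<Rightarrow> 'g \<Rightarrow> 'g \<Rightarrow> complex" +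
  fixes Q :: "'w \<Rightarrow> 'v" and K :: "'k set" and s t :: "'k \<Rightarrow> 'g"
  assumes clinear_Q: "clinear Q"
    and d_Q: "d (Q h) = h"
    and ce_diff_omega: "ce_diff2 br act2 (\<lambda>X Y. Q (\<alpha> X Y)) X Y Z = i (\<gamma> X Y Z)"
    and clinear_gamma: "clinear (\<gamma> X Y)"
    and r_symmetric: "(\<Sum>k\<in>K. t k \<otimes> s k) = (\<Sum>k\<in>K. s k \<otimes> t k)"
    and r_invariant: "(\<Sum>k\<in>K. br X (s k) \<otimes> t k + s k \<otimes> br X (t k)) = 0"
    and r_reproducing: "(\<Sum>k\<in>K. \<gamma> X Y (s k) *\<^sub>C t k) = br X Y"
begin

lemma clinear_i: "clinear i"
  and clinear_d: "clinear d"
  using hom_i hom_d by (simp_all add: lie_module_hom_def)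

lemma alternating_alpha: "alternating2 \<alpha>"
  using cocycle_alpha by (simp add: cocycle2_def)

lemma cbilinear_alpha: "cbilinear \<alpha>"
  using alternating_alpha by (simp add: alternating2_def)

lemmas alpha_anti = alternating2_anti[OF alternating_alpha]

lemmas act2_simps = cbilinear_simps[OF V2.cbilinear_act]
lemmas act3_simps = cbilinear_simps[OF V3.cbilinear_act]
lemmas alpha_simps = cbilinear_simps[OF cbilinear_alpha]
lemmas d_simps = clinear_simps[OF clinear_d]
lemmas Q_simps = clinear_simps[OF clinear_Q]

lemma d_act2: "d (act2 X v) = act3 X (d v)"
  using hom_d by (simp add: lie_module_hom_def)

lemma d_i: "d (i z) = 0"
  using exact by auto

lemma act2_i: "act2 X (i z) = 0"
  using hom_i by (simp add: lie_module_hom_def clinear_zero[OF clinear_i])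

text \<open>The kernel of \<open>d\<close> is the image of the trivial module, so acting on a lift
  along \<open>d\<close> does not depend on the lift.\<close>

lemma act2_eq:
  assumes "d u = d v"
  shows "act2 X u = act2 X v"
proof -
  have "u - v \<in> range i"
    using assms by (simp add: exact d_simps)
  then have "act2 X (u - v) = 0"
    by (auto simp: act2_i)
  then show ?thesis by (simp add: act2_simps)
qed

abbreviation "brE \<equiv> abelian_ext_br br act3 \<alpha>"
abbreviation "actE \<equiv> abelian_ext_act act2 :: 'w \<times> 'g \<Rightarrow> 'v \<Rightarrow> 'v"
abbreviation "\<mu> \<equiv> abelian_mu d :: 'v \<Rightarrow> 'w \<times> 'g"

lemma actE_eq: "actE e = act2 (snd e)"
  by (simp add: abelian_ext_act_def split_beta)

abbreviation bar :: "'g \<Rightarrow> 'w \<times> 'g"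
  where "bar X \<equiv> (0, X)"

lemma clinear_mu: "clinear \<mu>"
  by (simp add: clinear_iff abelian_mu_def d_simps scaleC_Pair)

lemma mu_i: "\<mu> (i z) = 0"
  by (simp add: abelian_mu_def d_i zero_prod_def)

section \<open>The crossed module of the extension\<close>

lemma lie_algebra_brE: "lie_algebra brE"
proof
  show "cbilinear brE"
    by (auto simp: cbilinear_iff abelian_ext_br_def act3_simps alpha_simps br_simps scaleC_Pair
        scaleC_add_right cvs.scale_right_diff_distrib)
  show "brE x x = 0" for x
    using alternating_alpha
    by (auto simp: abelian_ext_br_def br_self alternating2_def zero_prod_def split: prod.splits)
  fix x y z :: "'w \<times> 'g"
  obtain h1 X h2 Y h3 Z where xyz: "x = (h1, X)" "y = (h2, Y)" "z = (h3, Z)"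
    by (cases x, cases y, cases z)
  have "ce_diff2 br act3 \<alpha> X Y Z = 0"
    using cocycle_alpha by (simp add: cocycle2_def)
  \<comment> \<open>The cocycle condition in cyclic form, matching the three summands of the Jacobi
    identity.\<close>
  then have "act3 X (\<alpha> Y Z) + act3 Y (\<alpha> Z X) + act3 Z (\<alpha> X Y)
      + \<alpha> X (br Y Z) + \<alpha> Y (br Z X) + \<alpha> Z (br X Y) = 0"
    by (simp add: ce_diff2_def alpha_anti[of Z X] alpha_anti[of X "br Y Z"] alpha_anti[of Y "br X Z"]
        alpha_anti[of Z "br X Y"] br_anti[of Z X] act3_simps alpha_simps algebra_simps)
  then show "brE x (brE y z) + brE y (brE z x) + brE z (brE x y) = 0"
    using jacobi[of X Y Z]
    by (simp add: xyz abelian_ext_br_def act3_simps V3.act_br zero_prod_def algebra_simps)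
qed

lemma crossed_module_abelian: "crossed_module (\<lambda>_ _. 0) brE actE \<mu>"
proof (intro crossed_module.intro crossed_module_axioms.intro)
  show "lie_algebra (\<lambda>_ _. 0 :: 'v)"
    by unfold_locales (simp_all add: cbilinear_iff)
  show "lie_algebra brE"
    by (rule lie_algebra_brE)
  show "lie_module brE actE"
  proof (intro lie_module.intro lie_module_axioms.intro lie_algebra_brE)
    show "cbilinear actE"
      by (auto simp: cbilinear_iff abelian_ext_act_def act2_simps scaleC_Pair)
    show "actE (brE x y) v = actE x (actE y v) - actE y (actE x v)" for x y v
      by (auto simp: abelian_ext_act_def abelian_ext_br_def V2.act_br split: prod.splits)
  qed
  show "clinear \<mu>" by (rule clinear_mu)
  show "\<mu> 0 = brE (\<mu> u) (\<mu> v)" for u v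
    by (simp add: abelian_mu_def abelian_ext_br_def d_simps act3_simps alpha_simps br_simps)
  show "actE X 0 = 0 + 0" for X
    by (simp add: abelian_ext_act_def act2_simps split: prod.splits)
  show "\<mu> (actE X u) = brE X (\<mu> u)" for X u
    by (auto simp: abelian_mu_def abelian_ext_br_def abelian_ext_act_def d_act2 act3_simps
        alpha_simps br_simps split: prod.splits)
  show "actE (\<mu> u) v = 0" for u v
    by (simp add: abelian_mu_def abelian_ext_act_def act2_simps)
qed

sublocale E: crossed_module "\<lambda>_ _. 0" brE actE \<mu>
  by (rule crossed_module_abelian)

section \<open>Identities of the r-matrix inside arbitrary bilinear maps\<close>

lemma r_invariant_lift:
  assumes "cbilinear f"
  shows "(\<Sum>k\<in>K. f (br X (s k)) (t k) + f (s k) (br X (t k))) = 0"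
proof -
  have "(\<Sum>k\<in>K. f (br X (s k)) (t k) + f (s k) (br X (t k)))
      = tensor_lift f (\<Sum>k\<in>K. br X (s k) \<otimes> t k + s k \<otimes> br X (t k))"
    by (simp only: clinear_simps[OF clinear_tensor_lift[OF assms]] tensor_lift_tensor[OF assms])
  also have "\<dots> = 0"
    by (simp only: r_invariant clinear_zero[OF clinear_tensor_lift[OF assms]])
  finally show ?thesis .
qed

lemma r_symmetric_lift:
  assumes "cbilinear f"
  shows "(\<Sum>k\<in>K. f (t k) (s k)) = (\<Sum>k\<in>K. f (s k) (t k))"
  by (simp only: tensor_lift_sum[OF assms, symmetric] r_symmetric)

text \<open>Symmetry of the r-matrix yields the second form from the first. The component in
  \<open>E \<otimes> V2\<close> contracts the leg \<open>t\<close>, the one in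
  \<open>V2 \<otimes> E\<close> the leg \<open>s\<close>.\<close>

lemma r_reproducing_lift:
  assumes "clinear g"
  shows "(\<Sum>k\<in>K. \<gamma> X Y (s k) *\<^sub>C g (t k)) = g (br X Y)"
    and "(\<Sum>k\<in>K. \<gamma> X Y (t k) *\<^sub>C g (s k)) = g (br X Y)"
proof -
  show 1: "(\<Sum>k\<in>K. \<gamma> X Y (s k) *\<^sub>C g (t k)) = g (br X Y)"
    by (simp only: r_reproducing[symmetric] clinear_simps[OF assms])
  have "cbilinear (\<lambda>a b. \<gamma> X Y a *\<^sub>C g b)"
    by (simp add: cbilinear_iff clinear_simps[OF clinear_gamma] clinear_simps[OF assms]
        scaleC_complex_def scaleC_add_left scaleC_add_right mult.commute)
  from r_symmetric_lift[OF this] 1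
  show "(\<Sum>k\<in>K. \<gamma> X Y (t k) *\<^sub>C g (s k)) = g (br X Y)"
    by simp
qed

section \<open>The map \<open>\<zeta>\<close> and its differential\<close>

definition \<zeta> :: "'w \<times> 'g \<Rightarrow> 'g \<Rightarrow> 'v"
  where "\<zeta> e a = Q (\<alpha> a (snd e)) + act2 a (Q (fst e))"

lemma cbilinear_zeta: "cbilinear \<zeta>"
  by (simp add: cbilinear_iff \<zeta>_def alpha_simps Q_simps act2_simps scaleC_prod_def scaleC_add_right
      algebra_simps)

lemmas clinear_zeta = cbilinear_right[OF cbilinear_zeta]

lemma brE_bar: "brE e (bar a) = bar (br (snd e) a) - \<mu> (\<zeta> e a)"
  by (cases e) (simp add: abelian_ext_br_def abelian_mu_def \<zeta>_def d_simps d_Q d_act2 act3_simps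
      alpha_anti[of _ a])

text \<open>View \<open>\<zeta> e\<close> as an element of Hom(g, V2), where X sends \<phi> to the
  map taking a to X \<phi>(a) - \<phi>([X, a]). The differential of \<open>\<zeta>\<close> is then
  -i \<gamma>: the terms in \<alpha> assemble to \<open>ce_diff2\<close>, those in \<open>Q\<close>
  cancel.\<close>

lemma zeta_bracket:
  "act2 (snd e) (\<zeta> f a) - act2 (snd f) (\<zeta> e a) - \<zeta> (brE e f) a
    = \<zeta> f (br (snd e) a) - \<zeta> e (br (snd f) a) - i (\<gamma> (snd e) (snd f) a)"
proof -
  obtain h X k Y where ef: "e = (h, X)" "f = (k, Y)"
    by (cases e, cases f)
  \<comment> \<open>\<open>Q\<close> may fail to be equivariant, but its defect lies in the kernel
    of \<open>d\<close>, which \<open>act2\<close> annihilates.\<close>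
  have Q: "act2 a (Q (act3 Z l)) = act2 a (act2 Z (Q l))" for Z l
    by (rule act2_eq) (simp add: d_Q d_act2)
  show ?thesis
    by (simp add: ef \<zeta>_def abelian_ext_br_def ce_diff_omega[symmetric] ce_diff2_def V2.act_br Q
        alpha_anti[of a] act2_simps Q_simps algebra_simps)
qed

section \<open>The triple, its symmetry, and conditions (a) and (b)\<close>

abbreviation "r \<equiv> \<Sum>k\<in>K. bar (s k) \<otimes> bar (t k)"
abbreviation "\<xi>\<^sub>0 \<equiv> xi0 act2 Q (\<lambda>X Y. Q (\<alpha> X Y)) K s t"
abbreviation "\<xi> e \<equiv> - \<xi>\<^sub>0 e - Cmap (i 1) e"

lemma xi0_eq:
  "\<xi>\<^sub>0 e = (\<Sum>k\<in>K. bar (s k) \<otimes> \<zeta> e (t k), \<Sum>k\<in>K. \<zeta> e (s k) \<otimes> bar (t k))"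
  by (cases e) (simp add: xi0_def \<zeta>_def sum_Pair tensor_simps sum.distrib)

lemma Cmap_eq: "Cmap one e = (bar (snd e) \<otimes> one, one \<otimes> bar (snd e))" for one :: 'v
  by (cases e) (simp add: Cmap_def)

lemma clinear_bar: "clinear bar"
  by (rule clinear_Pair)

lemmas bar_tensor_simps =
  clinear_simps[OF clinear_comp[OF cbilinear_left[OF cbilinear_tensor] clinear_bar]]
  clinear_simps[OF clinear_comp[OF cbilinear_right[OF cbilinear_tensor] clinear_bar]]

lemma clinear_xi: "clinear \<xi>"
proof -
  note z = cbilinear_left[OF cbilinear_zeta, THEN clinear_add]
    cbilinear_left[OF cbilinear_zeta, THEN clinear_scale]
  have "clinear \<xi>\<^sub>0"
    by (simp add: clinear_iff xi0_eq z tensor_simps sum.distrib scaleC_Pair cvs.scale_sum_right)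
  moreover have "clinear (Cmap (i 1) :: 'w \<times> 'g \<Rightarrow> _)"
    by (auto simp: clinear_iff Cmap_eq bar_tensor_simps scaleC_Pair)
  ultimately show ?thesis
    by (simp add: clinear_iff cvs.scale_right_diff_distrib)
qed

text \<open>The flip exchanges the two components and the roles of \<open>s\<close> and
  \<open>t\<close>; the symmetry of the r-matrix undoes the latter.\<close>

lemma xi_flip: "mixed_flip (\<xi> e) = \<xi> e"
proof -
  have "(\<Sum>k\<in>K. bar (t k) \<otimes> \<zeta> e (s k)) = (\<Sum>k\<in>K. bar (s k) \<otimes> \<zeta> e (t k))"
    by (rule r_symmetric_lift[OF cbilinear_comp[OF cbilinear_tensor clinear_bar clinear_zeta]])
  moreover have "(\<Sum>k\<in>K. \<zeta> e (t k) \<otimes> bar (s k)) = (\<Sum>k\<in>K. \<zeta> e (s k) \<otimes> bar (t k))"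
    by (rule r_symmetric_lift[OF cbilinear_comp[OF cbilinear_tensor clinear_zeta clinear_bar]])
  ultimately show ?thesis
    by (simp add: mixed_flip_def xi0_eq Cmap_eq clinear_simps[OF clinear_tensor_flip] tensor_flip_sum
        tensor_flip_tensor)
qed

lemma clinear_brE: "clinear (brE e)"
  using E.n.cbilinear_br by (rule cbilinear_right)

lemma clinear_actE: "clinear (actE e)"
  using E.act.cbilinear_act by (rule cbilinear_right)

text \<open>By \<open>brE_bar\<close>, acting on a leg gives a lifted bracket and a term
  \<open>- \<mu> (\<zeta> e _)\<close>. The former cancel by invariance and the latter are the image
  of \<open>- \<xi>\<^sub>0 e\<close>; the image of \<open>Cmap\<close> vanishes because
  \<open>\<mu> (i 1) = 0\<close>.\<close>

lemma act_r: "tensor_act brE brE e r = mixed_beta \<mu> (\<xi> e)"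
proof -
  have beta: "cbilinear (\<lambda>X v. X \<otimes> \<mu> v)" "cbilinear (\<lambda>v X. \<mu> v \<otimes> X)"
    by (intro cbilinear_comp[OF cbilinear_tensor] clinear_ident clinear_mu)+
  have "tensor_act brE brE e r
      = (\<Sum>k\<in>K. bar (br (snd e) (s k)) \<otimes> bar (t k) + bar (s k) \<otimes> bar (br (snd e) (t k)))
        - (\<Sum>k\<in>K. \<mu> (\<zeta> e (s k)) \<otimes> bar (t k)) - (\<Sum>k\<in>K. bar (s k) \<otimes> \<mu> (\<zeta> e (t k)))"
    by (simp add: tensor_act_sum[where acta = brE, where actb = brE, OF clinear_brE clinear_brE]
        brE_bar tensor_simps sum.distrib sum_subtractf)
  also have "(\<Sum>k\<in>K. bar (br (snd e) (s k)) \<otimes> bar (t k) + bar (s k) \<otimes> bar (br (snd e) (t k))) = 0"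
    by (rule r_invariant_lift[OF cbilinear_comp[OF cbilinear_tensor clinear_bar clinear_bar]])
  also have "0 - (\<Sum>k\<in>K. \<mu> (\<zeta> e (s k)) \<otimes> bar (t k)) - (\<Sum>k\<in>K. bar (s k) \<otimes> \<mu> (\<zeta> e (t k)))
      = mixed_beta \<mu> (\<xi> e)"
  proof -
    show ?thesis
      by (simp add: mu_i mixed_beta_def xi0_eq Cmap_eq beta[THEN clinear_tensor_lift, THEN clinear_diff]
          beta[THEN clinear_tensor_lift, THEN clinear_minus] beta[THEN tensor_lift_sum]
          beta[THEN tensor_lift_tensor] tensor_simps)
  qed
  finally show ?thesis .
qed

lemma m_act_r: "m_act actE u r = \<xi> (\<mu> u)"
proof -
  \<comment> \<open>\<open>Q (d u)\<close> and \<open>u\<close> have the same image under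
    \<open>d\<close>, so they are acted on alike.\<close>
  have "\<zeta> (\<mu> u) a = act2 a u" for a
    by (simp add: \<zeta>_def abelian_mu_def alpha_simps Q_simps act2_eq[of "Q (d u)" u] d_Q)
  moreover have bil: "cbilinear (\<lambda>e f. e \<otimes> actE f u)" "cbilinear (\<lambda>e f. actE e u \<otimes> f)"
    by (intro cbilinear_comp[OF cbilinear_tensor] clinear_ident
        cbilinear_left[OF E.act.cbilinear_act])+
  ultimately show ?thesis
    unfolding m_act_def bil[THEN tensor_lift_sum]
    by (simp add: xi0_eq Cmap_eq actE_eq abelian_mu_def tensor_simps zero_prod_def[symmetric])
qed

section \<open>Condition (c)\<close>

lemma mixed_act_xi0:
  "mixed_act brE actE e (\<xi>\<^sub>0 f) - mixed_act brE actE f (\<xi>\<^sub>0 e) - \<xi>\<^sub>0 (brE e f)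
    = - Cmap (i 1) (bar (br (snd e) (snd f)))
      + (\<Sum>k\<in>K. mixed_null \<mu> (\<zeta> f (s k)) (\<zeta> e (t k)) - mixed_null \<mu> (\<zeta> e (s k)) (\<zeta> f (t k)))"
proof -
  let ?X = "snd e" and ?Y = "snd f" and ?one = "i 1"
  \<comment> \<open>Makes \<gamma> a scalar coefficient of the fixed vector \<open>i 1\<close>, so
    that the r-matrix can contract it.\<close>
  have i: "i z = z *\<^sub>C ?one" for z
    using clinear_scale[OF clinear_i, of z 1] by (simp add: scaleC_complex_def)
  have left: "(\<Sum>k\<in>K. bar (br ?X (s k)) \<otimes> \<zeta> f (t k) + bar (s k) \<otimes> \<zeta> f (br ?X (t k))) = 0"
    "(\<Sum>k\<in>K. bar (br ?Y (s k)) \<otimes> \<zeta> e (t k) + bar (s k) \<otimes> \<zeta> e (br ?Y (t k))) = 0"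
    "(\<Sum>k\<in>K. \<gamma> ?X ?Y (t k) *\<^sub>C bar (s k) \<otimes> ?one) = bar (br ?X ?Y) \<otimes> ?one"
    by (intro r_invariant_lift cbilinear_comp[OF cbilinear_tensor clinear_bar clinear_zeta]
        r_reproducing_lift(2)[where g = "\<lambda>a. bar a \<otimes> ?one"]
        clinear_comp[OF cbilinear_left[OF cbilinear_tensor] clinear_bar])+
  have right: "(\<Sum>k\<in>K. \<zeta> f (br ?X (s k)) \<otimes> bar (t k) + \<zeta> f (s k) \<otimes> bar (br ?X (t k))) = 0"
    "(\<Sum>k\<in>K. \<zeta> e (br ?Y (s k)) \<otimes> bar (t k) + \<zeta> e (s k) \<otimes> bar (br ?Y (t k))) = 0"
    "(\<Sum>k\<in>K. \<gamma> ?X ?Y (s k) *\<^sub>C ?one \<otimes> bar (t k)) = ?one \<otimes> bar (br ?X ?Y)"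
    by (intro r_invariant_lift cbilinear_comp[OF cbilinear_tensor clinear_zeta clinear_bar]
        r_reproducing_lift(1)[where g = "\<lambda>a. ?one \<otimes> bar a"]
        clinear_comp[OF cbilinear_right[OF cbilinear_tensor] clinear_bar])+
  \<comment> \<open>Solved for the action of \<open>?X\<close>, so that rewriting supplies exactly
    the terms that complete the two invariance sums and leaves \<gamma> behind.\<close>
  have zeta: "act2 ?X (\<zeta> f a) = act2 ?Y (\<zeta> e a) + \<zeta> (brE e f) a
      + \<zeta> f (br ?X a) - \<zeta> e (br ?Y a) - \<gamma> ?X ?Y a *\<^sub>C ?one" for a
    using zeta_bracket[of e f a] by (simp add: i[of "\<gamma> _ _ _"] algebra_simps)
  have "tensor_act brE actE e (fst (\<xi>\<^sub>0 f)) - tensor_act brE actE f (fst (\<xi>\<^sub>0 e)) - fst (\<xi>\<^sub>0 (brE e f))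
      = (\<Sum>k\<in>K. bar (br ?X (s k)) \<otimes> \<zeta> f (t k) + bar (s k) \<otimes> \<zeta> f (br ?X (t k)))
        - (\<Sum>k\<in>K. bar (br ?Y (s k)) \<otimes> \<zeta> e (t k) + bar (s k) \<otimes> \<zeta> e (br ?Y (t k)))
        - (\<Sum>k\<in>K. \<gamma> ?X ?Y (t k) *\<^sub>C bar (s k) \<otimes> ?one)
        + (\<Sum>k\<in>K. \<mu> (\<zeta> f (s k)) \<otimes> \<zeta> e (t k) - \<mu> (\<zeta> e (s k)) \<otimes> \<zeta> f (t k))"
    unfolding xi0_eq fst_conv tensor_act_sum[where acta = brE, where actb = actE, OF clinear_brE clinear_actE]
      brE_bar actE_eq zeta tensor_simps sum.distrib sum_subtractf
    by (simp add: algebra_simps)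
  moreover have "tensor_act actE brE e (snd (\<xi>\<^sub>0 f)) - tensor_act actE brE f (snd (\<xi>\<^sub>0 e)) - snd (\<xi>\<^sub>0 (brE e f))
      = (\<Sum>k\<in>K. \<zeta> f (br ?X (s k)) \<otimes> bar (t k) + \<zeta> f (s k) \<otimes> bar (br ?X (t k)))
        - (\<Sum>k\<in>K. \<zeta> e (br ?Y (s k)) \<otimes> bar (t k) + \<zeta> e (s k) \<otimes> bar (br ?Y (t k)))
        - (\<Sum>k\<in>K. \<gamma> ?X ?Y (s k) *\<^sub>C ?one \<otimes> bar (t k))
        + (\<Sum>k\<in>K. \<zeta> e (s k) \<otimes> \<mu> (\<zeta> f (t k)) - \<zeta> f (s k) \<otimes> \<mu> (\<zeta> e (t k)))"
    unfolding xi0_eq snd_conv tensor_act_sum[where acta = actE, where actb = brE, OF clinear_actE clinear_brE]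
      brE_bar actE_eq zeta tensor_simps sum.distrib sum_subtractf
    by (simp add: algebra_simps)
  ultimately show ?thesis
    \<comment> \<open>The invariance sums vanish and the \<gamma> sums become \<open>Cmap\<close>.
      The surviving terms with a leg in the image of \<open>\<mu>\<close> pair across the two
      components into values of \<open>mixed_null\<close>.\<close>
    unfolding left right
    by (simp add: prod_eq_iff mixed_act_def split_beta Cmap_eq mixed_null_def fst_sum snd_sum)
qed

text \<open>As \<open>i 1\<close> is invariant, only the lifted leg moves. The two actions produce
  the bracket twice and \<open>Cmap (i 1) (brE e f)\<close> removes one copy. The remaining terms
  are values of \<open>mixed_null\<close> with one component zero because
  \<open>\<mu> (i 1) = 0\<close>.\<close>

lemma mixed_act_Cmap:
  "mixed_act brE actE e (Cmap (i 1) f) - mixed_act brE actE f (Cmap (i 1) e) - Cmap (i 1) (brE e f)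
    = Cmap (i 1) (bar (br (snd e) (snd f)))
      + mixed_null \<mu> (\<zeta> f (snd e) - \<zeta> e (snd f)) (i 1)
      - mixed_null \<mu> (i 1) (\<zeta> f (snd e) - \<zeta> e (snd f))"
proof -
  have act: "tensor_act brE actE g (bar a \<otimes> i 1) = brE g (bar a) \<otimes> i 1"
    "tensor_act actE brE g (i 1 \<otimes> bar a) = i 1 \<otimes> brE g (bar a)" for g a
    \<comment> \<open>A one-element index set turns the formula for sums into one for pure
      tensors.\<close>
    using tensor_act_sum[where acta = brE and actb = actE and K = "{()}" and a = "\<lambda>_. bar a"
        and b = "\<lambda>_. i 1", OF clinear_brE clinear_actE]
      tensor_act_sum[where acta = actE and actb = brE and K = "{()}" and a = "\<lambda>_. i 1"
        and b = "\<lambda>_. bar a", OF clinear_actE clinear_brE]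
    by (simp_all add: actE_eq act2_i tensor_simps)
  have snd: "snd (brE e f) = br (snd e) (snd f)"
    by (simp add: abelian_ext_br_def split_beta)
  show ?thesis
    by (intro prod_eqI) (simp_all add: mixed_act_def mu_i Cmap_eq mixed_null_def act snd brE_bar
        br_anti[of "snd f" "snd e"] bar_tensor_simps clinear_simps[OF clinear_mu] tensor_simps)
qed

lemma clinear_mixed_act: "clinear (mixed_act brE actE e)"
  using clinear_tensor_act[where acta = brE and actb = actE, OF clinear_brE clinear_actE]
    clinear_tensor_act[where acta = actE and actb = brE, OF clinear_actE clinear_brE]
  by (auto simp: clinear_iff mixed_act_def scaleC_Pair)

lemma xi_br:
  "U2_eq (\<lambda>_ _. 0) brE actE \<mu> (mixed_embed (\<xi> (brE e f)))
    (mixed_embed (mixed_act brE actE e (\<xi> f) - mixed_act brE actE f (\<xi> e)))"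
proof (rule U2_eq_mixed_embed[OF clinear_mu])
  let ?N = "cvs.span (range (case_prod (mixed_null \<mu>)))"
  have null: "mixed_null \<mu> u v \<in> ?N" for u v
    by (rule cvs.span_base) auto
  let ?w = "\<zeta> f (snd e) - \<zeta> e (snd f)"
  have "\<xi> (brE e f) - (mixed_act brE actE e (\<xi> f) - mixed_act brE actE f (\<xi> e))
      = (mixed_act brE actE e (\<xi>\<^sub>0 f) - mixed_act brE actE f (\<xi>\<^sub>0 e) - \<xi>\<^sub>0 (brE e f))
        + (mixed_act brE actE e (Cmap (i 1) f) - mixed_act brE actE f (Cmap (i 1) e)
           - Cmap (i 1) (brE e f))"
    by (simp add: clinear_simps[OF clinear_mixed_act] algebra_simps)
  \<comment> \<open>The \<open>Cmap\<close> terms of the two preceding lemmas have opposite signs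
    and cancel, leaving only elementary relations.\<close>
  also have "\<dots> = (\<Sum>k\<in>K. mixed_null \<mu> (\<zeta> f (s k)) (\<zeta> e (t k)) - mixed_null \<mu> (\<zeta> e (s k)) (\<zeta> f (t k)))
      + (mixed_null \<mu> ?w (i 1) - mixed_null \<mu> (i 1) ?w)"
    unfolding mixed_act_xi0 mixed_act_Cmap by simp
  also have "\<dots> \<in> ?N"
    by (intro cvs.span_add cvs.span_sum cvs.span_diff null)
  finally show "\<xi> (brE e f) - (mixed_act brE actE e (\<xi> f) - mixed_act brE actE f (\<xi> e)) \<in> ?N" .
qed

lemma quasi_invariant_tensor:
  assumes "\<mu> c = 0"
  shows "quasi_invariant_tensor (\<lambda>_ _. 0) brE actE \<mu> r \<xi> c"
proof (intro quasi_invariant_tensor.intro quasi_invariant_tensor_axioms.intro)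
  show "tensor_flip r = r"
    unfolding tensor_flip_sum
    by (rule r_symmetric_lift[OF cbilinear_comp[OF cbilinear_tensor clinear_bar clinear_bar]])
  show "U2_eq (\<lambda>_ _. 0) brE actE \<mu> (mixed_embed (m_act actE u r)) (mixed_embed (\<xi> (\<mu> u)))" for u
    by (rule U2_eq_mixed_embed[OF clinear_mu]) (simp add: m_act_r cvs.span_zero)
  \<comment> \<open>\<open>c\<close> has the same image under \<open>d\<close> as 0, so
    \<open>act2_eq\<close> makes it invariant.\<close>
  have "d c = d 0"
    using assms by (simp add: abelian_mu_def zero_prod_def d_simps)
  then show "actE X c = 0" for X
    using act2_eq[of c 0] by (simp add: abelian_ext_act_def split_beta act2_simps)
qed (rule crossed_module_abelian clinear_xi xi_flip assms act_r xi_br)+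

end

section \<open>The case of the Cartan cocycle\<close>

theorem corollary3:
  fixes br :: "'g::complex_vs \<Rightarrow> 'g \<Rightarrow> 'g"
    and act2 :: "'g \<Rightarrow> 'v::complex_vs \<Rightarrow> 'v"
    and act3 :: "'g \<Rightarrow> 'w::complex_vs \<Rightarrow> 'w"
    and i :: "complex \<Rightarrow> 'v" and d :: "'v \<Rightarrow> 'w"
    and \<alpha> :: "'g \<Rightarrow> 'g \<Rightarrow> 'w" and Q :: "'w \<Rightarrow> 'v"
    and J :: "'j set" and x y :: "'j \<Rightarrow> 'g"
    and I :: "'k set" and s t :: "'k \<Rightarrow> 'g"
    and c :: 'v
  assumes "semisimple br"
    and "abelian_representative br act2 act3 i d \<alpha> (cartan_cocycle br)"
    and "clinear Q" and "\<And>h. d (Q h) = h"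
    and "\<And>X Y Z. ce_diff2 br act2 (\<lambda>X Y. Q (\<alpha> X Y)) X Y Z = i (cartan_cocycle br X Y Z)"
    and "killing_dual_bases br J x y"
    and "finite I" and "(\<Sum>k\<in>I. s k \<otimes> t k) = standard_r_matrix J x y"
    and "(abelian_mu d c :: 'w \<times> 'g) = 0"
  shows "quasi_invariant_tensor (\<lambda>_ _. 0) (abelian_ext_br br act3 \<alpha>) (abelian_ext_act act2)
           (abelian_mu d)
           (\<Sum>k\<in>I. (0, s k) \<otimes> (0, t k))
           (\<lambda>e. - xi0 act2 Q (\<lambda>X Y. Q (\<alpha> X Y)) I s t e - Cmap (i 1) e)
           c"
proof -
  interpret abelian_representative br act2 act3 i d \<alpha> "cartan_cocycle br"
    by (rule assms(2))
  interpret killing_dual br J x y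
    using assms(1,6) by unfold_locales (simp_all add: semisimple_def)
  interpret abelian_r_matrix br act2 act3 i d \<alpha> "cartan_cocycle br" Q I s t
  proof (intro abelian_r_matrix.intro abelian_r_matrix_axioms.intro)
    show "clinear (cartan_cocycle br X Y)" for X Y
      unfolding cartan_cocycle_def by (rule cbilinear_right[OF cbilinear_killing[OF fin_dim]])
    \<comment> \<open>The reproducing property at \<open>Z = br X Y\<close>.\<close>
    show "(\<Sum>k\<in>I. cartan_cocycle br X Y (s k) *\<^sub>C t k) = br X Y" for X Y
      unfolding cartan_cocycle_def by (rule standard_reproducing[OF assms(8)])
  qed (rule assms(2,3,4,5) standard_symmetric[OF assms(8)] standard_invariant[OF assms(8)])+
  show ?thesis
    using assms(9) by (rule quasi_invariant_tensor)
qed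

end
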